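(* Let $X\subset\mathbb{C}^m$ be an unbounded algebraic set of pure dimension $k$. Let $W\subset\mathbb{C}^m$ be an $(m-k)$-dimensional complex vector subspace with $W\cap C_{3,\infty}(X)=\{0\}$, let $V$ be the orthogonal complement of $W$, and use linear coordinates $(x,y)\in V\times W=\mathbb{C}^m$ with $x\in V\cong\mathbb{C}^k$ and $y=(y_1,\ldots,y_{m-k})\in W$. Fix $i\in\{1,\ldots,m-k\}$, let $W^i:=\{(0,y)\in\mathbb{C}^m\mid y_i=0\}$, and let $\pi_i:\mathbb{C}^m=V\times W\to\mathbb{C}^k\times\mathbb{C}=\mathbb{C}^{k+1}$ be the projection $\pi_i(x,y)=(x,y_i)$. Suppose that $C_{5,\infty}(X)\cap W^i=\{0\}$. Then $\pi_i(X)$ is an algebraic hypersurface in $\mathbb{C}^{k+1}$ and, for all sufficiently large $R$, the restriction $\pi_i:X\setminus\bar B_R\to\pi_i(X\setminus\bar B_R)$ is a homeomorphism.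
   Context: For an unbounded pure $k$-dimensional (complex, closed) algebraic set $X\subset\mathbb{C}^m$: - $C_{3,\infty}(X)$ is the set of $v\in\mathbb{C}^m$ for which there exist sequences $(p_j)_j$ in $X$ and $(t_j)_j$ in $\mathbb{C}$ with $\lim_{j\to\infty}\|p_j\|=\infty$ and $\lim_{j\to\infty}t_jp_j=v$. - $C_{5,\infty}(X)$ is the set of $v\in\mathbb{C}^m$ for which there exist sequences $(p_j)_j$ and $(q_j)_j$ in $X$ and $(t_j)_j$ in $\mathbb{C}$ with $\lim_{j\to\infty}\|p_j\|=\lim_{j\to\infty}\|q_j\|=\infty$ and $\lim_{j\to\infty}t_j(p_j-q_j)=v$. $B_R$ denotes the ball in $\mathbb{C}^m$ of radius $R$ centered at the origin and $\bar B_R$ its closure. Topological notions refer to the Euclidean topology. *)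

theory Defs
  imports "HOL-Analysis.Analysis"
begin

section \<open>Algebraic sets and their dimension\<close>

text \<open>
  Polynomials enter only through the functions they induce; since the field of complex numbers
  is infinite, nothing is lost. The definition is the complex analogue of
  \<^const>\<open>real_polynomial_function\<close>.
\<close>

inductive complex_polynomial_function :: "(complex ^ 'n \<Rightarrow> complex) \<Rightarrow> bool" where
  const: "complex_polynomial_function (\<lambda>z. c)"
| coord: "complex_polynomial_function (\<lambda>z. z $ j)"
| add: "complex_polynomial_function f \<Longrightarrow> complex_polynomial_function g \<Longrightarrow>
    complex_polynomial_function (\<lambda>z. f z + g z)"
| mult: "complex_polynomial_function f \<Longrightarrow> complex_polynomial_function g \<Longrightarrow>
    complex_polynomial_function (\<lambda>z. f z * g z)"

definition algebraic_set :: "(complex ^ 'n) set \<Rightarrow> bool" where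
  "algebraic_set A \<longleftrightarrow>
     (\<exists>F. (\<forall>f\<in>F. complex_polynomial_function f) \<and> A = {z. \<forall>f\<in>F. f z = 0})"

definition irreducible_algebraic_set :: "(complex ^ 'n) set \<Rightarrow> bool" where
  "irreducible_algebraic_set A \<longleftrightarrow>
     algebraic_set A \<and> A \<noteq> {} \<and>
     (\<forall>B C. algebraic_set B \<longrightarrow> algebraic_set C \<longrightarrow> A = B \<union> C \<longrightarrow> A = B \<or> A = C)"

definition irreducible_component_of :: "(complex ^ 'n) set \<Rightarrow> (complex ^ 'n) set \<Rightarrow> bool" where
  "irreducible_component_of C A \<longleftrightarrow>
     irreducible_algebraic_set C \<and> C \<subseteq> A \<and>
     (\<forall>D. irreducible_algebraic_set D \<longrightarrow> C \<subseteq> D \<longrightarrow> D \<subseteq> A \<longrightarrow> D = C)"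

text \<open>
  Krull dimension for the Zariski topology: the supremum of the lengths \<open>n\<close> of chains
  \<open>Z 0 \<subset> Z 1 \<subset> \<dots> \<subset> Z n\<close> of irreducible algebraic subsets. The empty set gets the junk value
  \<open>0\<close>; below the dimension is only taken of irreducible sets, which are nonempty.
\<close>

definition algebraic_dim :: "(complex ^ 'n) set \<Rightarrow> enat" where
  "algebraic_dim A =
     Sup {enat n | n. \<exists>Z. (\<forall>j\<le>n. irreducible_algebraic_set (Z j) \<and> Z j \<subseteq> A) \<and>
                          (\<forall>j<n. Z j \<subset> Z (Suc j))}"

definition pure_dimensional_algebraic_set :: "nat \<Rightarrow> (complex ^ 'n) set \<Rightarrow> bool" where
  "pure_dimensional_algebraic_set k A \<longleftrightarrow>
     algebraic_set A \<and> (\<forall>C. irreducible_component_of C A \<longrightarrow> algebraic_dim C = enat k)"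

text \<open>A hypersurface is a nonempty algebraic set of pure codimension one.\<close>

definition algebraic_hypersurface :: "(complex ^ 'n) set \<Rightarrow> bool" where
  "algebraic_hypersurface A \<longleftrightarrow>
     A \<noteq> {} \<and> pure_dimensional_algebraic_set (CARD('n) - 1) A"


section \<open>Tangent cones at infinity\<close>

definition C3_inf :: "(complex ^ 'n) set \<Rightarrow> (complex ^ 'n) set" where
  "C3_inf X = {v. \<exists>p t. (\<forall>j::nat. p j \<in> X) \<and>
     filterlim (\<lambda>j. norm (p j)) at_top sequentially \<and>
     (\<lambda>j. t j *s p j) \<longlonglongrightarrow> v}"

definition C5_inf :: "(complex ^ 'n) set \<Rightarrow> (complex ^ 'n) set" where
  "C5_inf X = {v. \<exists>p q t. (\<forall>j::nat. p j \<in> X \<and> q j \<in> X) \<and>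
     filterlim (\<lambda>j. norm (p j)) at_top sequentially \<and>
     filterlim (\<lambda>j. norm (q j)) at_top sequentially \<and>
     (\<lambda>j. t j *s (p j - q j)) \<longlonglongrightarrow> v}"


section \<open>Linear coordinates\<close>

text \<open>Orthogonality refers to the Hermitian product of complex \<open>n\<close>-space.\<close>

definition hermitian_complement :: "(complex ^ 'n) set \<Rightarrow> (complex ^ 'n) set" where
  "hermitian_complement W = {v. \<forall>w\<in>W. (\<Sum>j\<in>UNIV. v $ j * cnj (w $ j)) = 0}"

text \<open>
  \<open>x\<close> and \<open>y\<close> are the coordinate functions of a decomposition of the ambient space as \<open>V \<times> W\<close>:
  for \<open>z = v + w\<close> with \<open>v \<in> V\<close> and \<open>w \<in> W\<close>, the vector \<open>x z\<close> consists of the coordinates of \<open>v\<close> in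
  some basis of \<open>V\<close>, and \<open>y z\<close> of those of \<open>w\<close> in some basis of \<open>W\<close>.
\<close>

definition linear_coordinates ::
  "(complex ^ 'm) set \<Rightarrow> (complex ^ 'm) set \<Rightarrow>
   (complex ^ 'm \<Rightarrow> complex ^ 'k) \<Rightarrow> (complex ^ 'm \<Rightarrow> complex ^ 'l) \<Rightarrow> bool" where
  "linear_coordinates V W x y \<longleftrightarrow>
     Vector_Spaces.linear (*s) (*s) x \<and> bij_betw x V UNIV \<and> (\<forall>w\<in>W. x w = 0) \<and>
     Vector_Spaces.linear (*s) (*s) y \<and> bij_betw y W UNIV \<and> (\<forall>v\<in>V. y v = 0)"

text \<open>
  The map sending a point with coordinates \<open>(x, y)\<close> to \<open>(x, y\<^sub>i)\<close>. Complex \<open>(k + 1)\<close>-space is indexed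
  by the option type over the index type of the \<open>x\<close>-coordinates; \<^const>\<open>None\<close> is the index of
  the additional coordinate.
\<close>

definition coordinate_projection ::
  "('a \<Rightarrow> complex ^ 'k) \<Rightarrow> ('a \<Rightarrow> complex ^ 'l) \<Rightarrow> 'l \<Rightarrow> 'a \<Rightarrow> complex ^ ('k option)" where
  "coordinate_projection x y i z =
     (\<chi> j. case j of None \<Rightarrow> y z $ i | Some a \<Rightarrow> x z $ a)"

end

theory Submission
  imports Defs "HOL-Computational_Algebra.Fundamental_Theorem_Algebra"
begin

text \<open>
  By the condition on \<open>C\<^sub>3\<close>, the map \<open>\<pi>\<close> is proper on \<open>X\<close>, since rescaling an unbounded sequence with
  bounded images would produce a nonzero vector of \<open>W \<inter> C\<^sub>3\<close>. In the same way the condition on \<open>C\<^sub>5\<close>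
  makes \<open>\<pi>\<close> injective on \<open>X\<close> near infinity, and a proper injective continuous map is a homeomorphism
  onto its image.

  For the algebraic part the point is that a projection that is proper on an algebraic set is
  finite in the algebraic sense: the eliminated coordinate satisfies a monic equation over the
  polynomials in the other ones. The minimal equation has locally bounded roots, so its leading
  coefficient divides the other coefficients. Consequently images of algebraic sets are algebraic
  (Nakayama), and irreducible chains can be pushed forward and lifted, so that dimension is
  preserved.
\<close>

section \<open>Polynomial functions in finitely many coordinates\<close>

text \<open>A minimal equation for the eliminated coordinate is at hand only if the ideal of the set
  is prime and no nonzero polynomial in the remaining coordinates vanishes on the set. Both
  conditions can fail, and induction removes the obstacles. If a product vanishes on the set but
  neither factor does, the set is the union of two smaller algebraic sets, and the product of their
  equations serves. A relation among the remaining coordinates becomes monic in one of them after a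
  shear, and this coordinate can then be eliminated. In the prime dominant case the divisibility is
  obtained analytically: a quotient of polynomials that is bounded on bounded sets is a polynomial,
  which takes the place of an argument by unique factorization. Noetherian induction also provides
  the finite decomposition into irreducible sets, through which single irreducible sets are lifted
  along a proper map. As dimension is measured by chains of irreducible sets, lifting chains and
  keeping their images strict is enough to compare the dimensions of source and image.\<close>

inductive polyfun :: "'a set \<Rightarrow> (('a \<Rightarrow> complex) \<Rightarrow> complex) \<Rightarrow> bool" for S where
  const: "polyfun S (\<lambda>z. c)"
| coord: "i \<in> S \<Longrightarrow> polyfun S (\<lambda>z. z i)"
| add: "polyfun S f \<Longrightarrow> polyfun S g \<Longrightarrow> polyfun S (\<lambda>z. f z + g z)"
| mult: "polyfun S f \<Longrightarrow> polyfun S g \<Longrightarrow> polyfun S (\<lambda>z. f z * g z)"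

lemma polyfun_uminus: "polyfun S f \<Longrightarrow> polyfun S (\<lambda>z. - f z)"
  using polyfun.mult[OF polyfun.const[of S "-1"], of f] by simp

lemma polyfun_diff: "polyfun S f \<Longrightarrow> polyfun S g \<Longrightarrow> polyfun S (\<lambda>z. f z - g z)"
  using polyfun.add[OF _ polyfun_uminus, of S f g] by simp

lemma polyfun_sum: "(\<And>i. i \<in> A \<Longrightarrow> polyfun S (f i)) \<Longrightarrow> polyfun S (\<lambda>z. \<Sum>i\<in>A. f i z)"
  by (induction A rule: infinite_finite_induct) (auto intro: polyfun.intros)

lemma polyfun_power: "polyfun S f \<Longrightarrow> polyfun S (\<lambda>z. f z ^ n)"
  by (induction n) (auto intro: polyfun.intros)

lemmas polyfun_intros = polyfun.intros polyfun_uminus polyfun_diff polyfun_sum polyfun_power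

text \<open>The set of variables is a parameter and not a type, so that inductions over
  \<open>S\<close> can remove a coordinate. This is the precise sense in which the other coordinates
  are ignored.\<close>

lemma polyfun_cong: "polyfun S f \<Longrightarrow> (\<And>i. i \<in> S \<Longrightarrow> z i = z' i) \<Longrightarrow> f z = f z'"
  by (induction rule: polyfun.induct) auto

lemma polyfun_compose:
  "polyfun S f \<Longrightarrow> (\<And>i. i \<in> S \<Longrightarrow> polyfun T (\<lambda>z. g z i)) \<Longrightarrow> polyfun T (\<lambda>z. f (g z))"
  by (induction rule: polyfun.induct) (auto intro: polyfun.intros)

lemma polyfun_mono: "polyfun S f \<Longrightarrow> S \<subseteq> T \<Longrightarrow> polyfun T f"
  by (induction rule: polyfun.induct) (auto intro: polyfun.intros)

lemma polyfun_bounded: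
  "polyfun S f \<Longrightarrow> \<exists>M. \<forall>z. (\<forall>i\<in>S. norm (z i) \<le> R) \<longrightarrow> norm (f z) \<le> M"
proof (induction rule: polyfun.induct)
  case (add f g)
  then obtain M N where "\<forall>z. (\<forall>i\<in>S. norm (z i) \<le> R) \<longrightarrow> norm (f z) \<le> M"
    "\<forall>z. (\<forall>i\<in>S. norm (z i) \<le> R) \<longrightarrow> norm (g z) \<le> N" by blast
  then show ?case by (intro exI[of _ "M + N"]) (auto intro: norm_triangle_mono)
next
  case (mult f g)
  then obtain M N where "\<forall>z. (\<forall>i\<in>S. norm (z i) \<le> R) \<longrightarrow> norm (f z) \<le> M"
    "\<forall>z. (\<forall>i\<in>S. norm (z i) \<le> R) \<longrightarrow> norm (g z) \<le> N" by blast
  then show ?case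
    by (intro exI[of _ "M * N"])
       (auto simp: norm_mult intro!: mult_mono intro: order_trans[OF norm_ge_zero])
qed auto

text \<open>A polynomial in one further variable over the ring of polynomial functions in the coordinates
  \<open>S\<close> is encoded by its specializations at the points \<open>z\<close>.\<close>

definition polyc :: "'a set \<Rightarrow> (('a \<Rightarrow> complex) \<Rightarrow> complex poly) \<Rightarrow> bool" where
  "polyc S P \<longleftrightarrow> (\<exists>d. \<forall>z. degree (P z) \<le> d) \<and> (\<forall>n. polyfun S (\<lambda>z. coeff (P z) n))"

lemma polycI:
  "(\<And>z. degree (P z) \<le> d) \<Longrightarrow> (\<And>n. polyfun S (\<lambda>z. coeff (P z) n)) \<Longrightarrow> polyc S P"
  unfolding polyc_def by blast

lemma polyc_coeff: "polyc S P \<Longrightarrow> polyfun S (\<lambda>z. coeff (P z) n)"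
  unfolding polyc_def by blast

lemma polyc_degree: "polyc S P \<Longrightarrow> \<exists>d. \<forall>z. degree (P z) \<le> d"
  unfolding polyc_def by blast

lemma polyc_const: "polyc S (\<lambda>z. p)"
  by (rule polycI[of _ "degree p"]) (auto intro: polyfun.const)

lemma polyc_monom: "polyfun S f \<Longrightarrow> polyc S (\<lambda>z. monom (f z) n)"
  by (rule polycI[of _ n], simp add: degree_monom_le, rename_tac m, case_tac "m = n")
     (auto intro: polyfun.const)

lemma polyc_add:
  assumes "polyc S P" "polyc S Q" shows "polyc S (\<lambda>z. P z + Q z)"
proof -
  obtain d e where "\<forall>z. degree (P z) \<le> d" "\<forall>z. degree (Q z) \<le> e"
    using assms polyc_degree by metis
  then have "degree (P z + Q z) \<le> max d e" for z
    by (meson degree_add_le_max le_trans max.mono)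
  then show ?thesis
    using assms by (intro polycI[of _ "max d e"]) (auto intro: polyfun_intros polyc_coeff)
qed

lemma polyc_mult:
  assumes "polyc S P" "polyc S Q" shows "polyc S (\<lambda>z. P z * Q z)"
proof -
  obtain d e where "\<forall>z. degree (P z) \<le> d" "\<forall>z. degree (Q z) \<le> e"
    using assms polyc_degree by metis
  then have "degree (P z * Q z) \<le> d + e" for z
    by (meson degree_mult_le le_trans add_mono)
  then show ?thesis
    using assms
    by (intro polycI[of _ "d + e"]) (auto simp: coeff_mult intro!: polyfun_intros polyc_coeff)
qed

lemma polyc_smult: "polyfun S f \<Longrightarrow> polyc S P \<Longrightarrow> polyc S (\<lambda>z. smult (f z) (P z))"
  using polyc_mult[OF polyc_monom[of S f 0], of P] by (simp add: monom_0)

lemma polyc_uminus: "polyc S P \<Longrightarrow> polyc S (\<lambda>z. - P z)"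
  using polyc_smult[OF polyfun.const[of S "-1"], of P] by simp

lemma polyc_diff: "polyc S P \<Longrightarrow> polyc S Q \<Longrightarrow> polyc S (\<lambda>z. P z - Q z)"
  using polyc_add[OF _ polyc_uminus, of S P Q] by simp

lemma polyc_sum: "(\<And>i. i \<in> A \<Longrightarrow> polyc S (P i)) \<Longrightarrow> polyc S (\<lambda>z. \<Sum>i\<in>A. P i z)"
  by (induction A rule: infinite_finite_induct) (auto intro: polyc_add polyc_const)

lemma polyc_mono: "polyc S P \<Longrightarrow> S \<subseteq> T \<Longrightarrow> polyc T P"
  unfolding polyc_def using polyfun_mono by blast

lemma polyc_compose:
  "polyc S P \<Longrightarrow> (\<And>i. i \<in> S \<Longrightarrow> polyfun T (\<lambda>z. g z i)) \<Longrightarrow> polyc T (\<lambda>z. P (g z))"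
  unfolding polyc_def by (auto intro: polyfun_compose[where f = "\<lambda>z. coeff (P z) _"])

lemma polyc_cong: "polyc S P \<Longrightarrow> (\<And>i. i \<in> S \<Longrightarrow> z i = z' i) \<Longrightarrow> P z = P z'"
  by (intro poly_eqI polyfun_cong[OF polyc_coeff])

section \<open>Substitution, restriction to lines, expansion in one coordinate\<close>

lemma poly_altdef': "degree (p :: complex poly) \<le> d \<Longrightarrow> poly p x = (\<Sum>i\<le>d. coeff p i * x ^ i)"
  unfolding poly_altdef by (intro sum.mono_neutral_left) (auto simp: coeff_eq_0)

lemma polyfun_poly:
  assumes "polyc S P" "polyfun S f" shows "polyfun S (\<lambda>z. poly (P z) (f z))"
proof -
  obtain d where "\<forall>z. degree (P z) \<le> d" using assms polyc_degree by metis
  then have "(\<lambda>z. poly (P z) (f z)) = (\<lambda>z. \<Sum>i\<le>d. coeff (P z) i * f z ^ i)"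
    using poly_altdef' by metis
  then show ?thesis using assms by (auto intro!: polyfun_intros polyc_coeff)
qed

text \<open>Base point and direction of the line may both vary polynomially with \<open>z\<close>.
  This one form yields the restriction to a fixed line, the expansion in one coordinate, the
  homogeneous parts and the effect of a shear.\<close>

lemma polyfun_affine:
  assumes "polyfun S f"
    and "\<And>i. i \<in> S \<Longrightarrow> polyfun T (\<lambda>z. A z i)" "\<And>i. i \<in> S \<Longrightarrow> polyfun T (\<lambda>z. B z i)"
  shows "\<exists>P. polyc T P \<and> (\<forall>z t. f (\<lambda>i. A z i + t * B z i) = poly (P z) t)"
  using assms(1)
proof (induction rule: polyfun.induct)
  case (const c)
  show ?case by (rule exI[of _ "\<lambda>z. [:c:]"]) (auto intro: polyc_const)
next
  case (coord i)
  have "polyc T (\<lambda>z. monom (A z i) 0 + monom (B z i) 1)"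
    by (intro polyc_add polyc_monom assms coord)
  then show ?case
    by (intro exI[of _ "\<lambda>z. monom (A z i) 0 + monom (B z i) 1"]) (auto simp: poly_monom)
next
  case (add f g)
  then obtain P Q where "polyc T P" "polyc T Q" 
    "\<forall>z t. f (\<lambda>i. A z i + t * B z i) = poly (P z) t"
    "\<forall>z t. g (\<lambda>i. A z i + t * B z i) = poly (Q z) t" by blast
  then show ?case by (intro exI[of _ "\<lambda>z. P z + Q z"]) (auto intro: polyc_add)
next
  case (mult f g)
  then obtain P Q where "polyc T P" "polyc T Q" 
    "\<forall>z t. f (\<lambda>i. A z i + t * B z i) = poly (P z) t"
    "\<forall>z t. g (\<lambda>i. A z i + t * B z i) = poly (Q z) t" by blast
  then show ?case by (intro exI[of _ "\<lambda>z. P z * Q z"]) (auto intro: polyc_mult)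
qed

lemma polyfun_line:
  assumes "polyfun S f"
  shows "\<exists>p. \<forall>t. f (\<lambda>i. a i + t * b i) = poly p t"
proof -
  \<comment> \<open>The parameter space is a dummy: the fixed vectors \<open>a\<close> and
    \<open>b\<close> are constant families over it.\<close>
  obtain P where "\<forall>(z :: unit \<Rightarrow> complex) t. f (\<lambda>i. a i + t * b i) = poly (P z) t"
    using polyfun_affine[OF assms, of UNIV "\<lambda>_ :: unit \<Rightarrow> complex. a" "\<lambda>_. b"]
    by (blast intro: polyfun.const)
  then show ?thesis by blast
qed

lemma polyfun_in_coord:
  assumes "polyfun (insert s S) f" "s \<notin> S"
  shows "\<exists>P. polyc S P \<and> (\<forall>z t. f (z(s := t)) = poly (P z) t) \<and> (\<forall>z. f z = poly (P z) (z s))"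
proof -
  \<comment> \<open>The line through \<open>z(s := 0)\<close> in the direction of the axis
    \<open>s\<close>; setting the coordinate to 0 keeps it out of the coefficients.\<close>
  have "\<exists>P. polyc S P \<and> (\<forall>z t. f (\<lambda>i. (z(s := 0)) i + t * (if i = s then 1 else 0)) = poly (P z) t)"
    using assms(1)
  proof (rule polyfun_affine)
    fix i assume "i \<in> insert s S"
    then show "polyfun S (\<lambda>z. (z(s := 0)) i)"
      by (cases "i = s") (auto intro: polyfun.intros)
  qed (rule polyfun.const)
  moreover have "(\<lambda>i. (z(s := 0)) i + t * (if i = s then 1 else 0)) = z(s := t)"
    for z :: "'a \<Rightarrow> complex" and t by auto
  ultimately have "\<exists>P. polyc S P \<and> (\<forall>z t. f (z(s := t)) = poly (P z) t)" by simp
  then show ?thesis using fun_upd_triv by metis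
qed

text \<open>The inequality extends to the zeros of \<open>h\<close> because these are nowhere dense on every complex
  line that joins the given point to a point where \<open>h\<close> does not vanish.\<close>

lemma polyfun_dense_le:
  fixes a :: "'a \<Rightarrow> complex"
  assumes "polyfun S f" "polyfun S g" "polyfun S h" "h b \<noteq> 0" "finite S"
    and R: "\<And>i. i \<in> S \<Longrightarrow> norm (a i) < R"
    and le: "\<And>z. (\<forall>i\<in>S. norm (z i) \<le> R) \<Longrightarrow> h z \<noteq> 0 \<Longrightarrow> norm (f z) \<le> norm (g z)"
  shows "norm (f a) \<le> norm (g a)"
proof -
  let ?l = "\<lambda>t i. a i + t * (b i - a i)"
  obtain p q r where pq: "\<And>t. f (?l t) = poly p t" "\<And>t. g (?l t) = poly q t"
     "\<And>t. h (?l t) = poly r t"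
    using polyfun_line[OF assms(1), of a "\<lambda>i. b i - a i"]
      polyfun_line[OF assms(2), of a "\<lambda>i. b i - a i"]
      polyfun_line[OF assms(3), of a "\<lambda>i. b i - a i"] by metis
  have "r \<noteq> 0" using pq(3)[of 1] assms(4) by auto
  then have "finite {t. poly r t = 0}" using poly_roots_finite by blast
  then have 1: "\<forall>\<^sub>F t in at 0. poly r t \<noteq> 0"
    using islimpt_finite islimpt_iff_eventually by fastforce
  \<comment> \<open>The bound on \<open>a\<close> is strict, so the points of the line near
    \<open>a\<close> remain in the polydisc where the inequality is known.\<close>
  have 2: "\<forall>\<^sub>F t in at 0. \<forall>i\<in>S. norm (?l t i) < R"
  proof (rule eventually_ball_finite[OF \<open>finite S\<close>], safe)
    fix i assume "i \<in> S"
    have "((\<lambda>t. norm (?l t i)) \<longlongrightarrow> norm (?l 0 i)) (at 0)" by (intro tendsto_intros)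
    then show "\<forall>\<^sub>F t in at 0. norm (?l t i) < R"
      using R[OF \<open>i \<in> S\<close>] by (intro order_tendstoD) auto
  qed
  have "\<forall>\<^sub>F t in at 0. norm (poly p t) \<le> norm (poly q t)"
    using 1 2
  proof eventually_elim
    case (elim t)
    then show ?case using le[of "?l t"] unfolding pq by (auto intro: less_imp_le)
  qed
  then have "norm (poly p 0) \<le> norm (poly q 0)"
    by (intro tendsto_le[of "at 0" "\<lambda>t. norm (poly q t)" _ "\<lambda>t. norm (poly p t)"])
       (auto intro!: tendsto_norm isContD)
  then show ?thesis using pq(1)[of 0] pq(2)[of 0] by simp
qed

lemma poly_eqI_punctured:
  assumes "\<And>t. t \<noteq> 0 \<Longrightarrow> poly p t = poly q t" shows "p = (q :: complex poly)"
proof -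
  \<comment> \<open>The factor \<open>[:0,1:]\<close> supplies the missing zero at 0.\<close>
  have "poly ([:0,1:] * (p - q)) t = 0" for t using assms by (cases "t = 0") auto
  then have "[:0,1:] * (p - q) = 0" using poly_all_0_iff_0 by blast
  then show ?thesis by (auto simp: mult_eq_0_iff)
qed

text \<open>The number \<open>d\<close> only bounds the degree of \<open>F\<close>, and the
  coefficient at \<open>d\<close> may vanish at some points; hence a power of it multiplies the
  dividend, with one exponent for all \<open>z\<close>. Bounding the remainder through its
  coefficients covers \<open>d = 0\<close>, where it has to vanish.\<close>

lemma polyc_pseudo_div:
  fixes P F :: "('a \<Rightarrow> complex) \<Rightarrow> complex poly"
  assumes P: "polyc S P" and F: "polyc S F" and d: "\<And>z. degree (F z) \<le> d"
  shows "\<exists>k Q R. polyc S Q \<and> polyc S R \<and> (\<forall>z. \<forall>n\<ge>d. coeff (R z) n = 0) \<and>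
    (\<forall>z. smult (coeff (F z) d ^ k) (P z) = Q z * F z + R z)"
proof -
  obtain n where "\<forall>z. degree (P z) \<le> n" using polyc_degree[OF P] by blast
  then have "\<forall>z. \<forall>m\<ge>Suc n. coeff (P z) m = 0"
    by (meson Suc_le_lessD coeff_eq_0 le_less_trans)
  with P show ?thesis
  proof (induction "Suc n" arbitrary: P n rule: less_induct)
    case (less n P)
    show ?case
    proof (cases "Suc n \<le> d")
      case True
      then have "polyc S (\<lambda>z. 0) \<and> polyc S P \<and> (\<forall>z. \<forall>n\<ge>d. coeff (P z) n = 0) \<and>
        (\<forall>z. smult (coeff (F z) d ^ 0) (P z) = 0 * F z + P z)"
        using less by (auto intro: polyc_const)
      then show ?thesis by blast
    next
      case False
      then have dn: "d \<le> n" by simp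
      let ?M = "\<lambda>z. monom (coeff (P z) n) (n - d)"
      let ?P = "\<lambda>z. smult (coeff (F z) d) (P z) - ?M z * F z"
      have M: "polyc S ?M" using less by (intro polyc_monom polyc_coeff)
      have P': "polyc S ?P"
        using less F M by (intro polyc_diff polyc_smult polyc_mult polyc_coeff)
      have z: "coeff (?P z) m = 0" if "m \<ge> n" for z m
      proof (cases "m = n")
        case True
        then show ?thesis using dn by (simp add: coeff_monom_mult)
      next
        case False
        then have "coeff (P z) m = 0" "coeff (F z) (m - (n - d)) = 0"
          using that less d[of z] dn by (auto intro!: coeff_eq_0)
        then show ?thesis by (simp add: coeff_monom_mult)
      qed
      have "\<exists>k Q R. polyc S Q \<and> polyc S R \<and> (\<forall>z. \<forall>n\<ge>d. coeff (R z) n = 0) \<and>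
         (\<forall>z. smult (coeff (F z) d ^ k) (?P z) = Q z * F z + R z)"
      \<comment> \<open>The induction hypothesis speaks only of bounds of the form
        \<open>Suc n'\<close>. For \<open>n = 0\<close> all coefficients of the reduced dividend
        vanish, and quotient and remainder 0 serve.\<close>
      proof (cases n)
        case 0
        then have "?P z = 0" for z using z by (intro poly_eqI) simp
        then show ?thesis
          by (intro exI[of _ 0] exI[of _ "\<lambda>z. 0"]) (auto intro: polyc_const)
      next
        case (Suc n')
        then show ?thesis using less(1)[of n' ?P] P' z by auto
      qed
      then obtain k Q R where QR: "polyc S Q" "polyc S R" "\<forall>z. \<forall>n\<ge>d. coeff (R z) n = 0"
         "\<And>z. smult (coeff (F z) d ^ k) (?P z) = Q z * F z + R z" by blast
      have "smult (coeff (F z) d ^ Suc k) (P z) =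
         (Q z + smult (coeff (F z) d ^ k) (?M z)) * F z + R z" for z
        using QR(4)[of z] by (simp add: smult_diff_right algebra_simps)
      moreover have "polyc S (\<lambda>z. Q z + smult (coeff (F z) d ^ k) (?M z))"
        using QR F M by (intro polyc_add polyc_smult polyfun_power polyc_coeff)
      ultimately show ?thesis using QR by blast
    qed
  qed
qed

text \<open>Here \<open>div\<close> and \<open>mod\<close> are formed separately at each point. For
  monic \<open>F\<close> the factor in pseudo-division is 1, and uniqueness of division shows that
  the pointwise results have polynomial coefficients.\<close>

lemma polyc_divmod_monic:
  assumes P: "polyc S P" and F: "polyc S F"
    and monic: "\<And>z. degree (F z) = d" "\<And>z. lead_coeff (F z) = 1"
  shows "polyc S (\<lambda>z. P z div F z)" "polyc S (\<lambda>z. P z mod F z)"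
proof -
  have "degree (F z) \<le> d" for z by (simp add: monic)
  from polyc_pseudo_div[OF P F this] obtain k Q R
    where QR: "polyc S Q" "polyc S R" "\<And>z n. n \<ge> d \<Longrightarrow> coeff (R z) n = 0"
      "\<And>z. smult (coeff (F z) d ^ k) (P z) = Q z * F z + R z" by blast
  have "P z = Q z * F z + R z" for z using QR(4)[of z] monic[of z] by simp
  moreover have "R z = 0 \<or> degree (R z) < degree (F z)" for z
    using QR(3)[of "degree (R z)" z] monic[of z] by (metis leading_coeff_0_iff not_le)
  moreover have "F z \<noteq> 0" for z using monic(2)[of z] by auto
  ultimately have "P z div F z = Q z \<and> P z mod F z = R z" for z
    by (metis add_0 add_0_right div_0 div_mult_self3 div_poly_less mod_0 mod_mult_self3 mod_poly_less)
  then have "(\<lambda>z. P z div F z) = Q" "(\<lambda>z. P z mod F z) = R" by auto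
  then show "polyc S (\<lambda>z. P z div F z)" "polyc S (\<lambda>z. P z mod F z)" using QR by auto
qed


section \<open>Shears\<close>

text \<open>For \<open>v u = 0\<close> this is an invertible linear map that fixes the coordinate
  \<open>u\<close>. It carries lines along the axis \<open>u\<close> to lines in the direction of
  \<open>v\<close> plus the unit vector at \<open>u\<close>.\<close>

definition shear :: "'a \<Rightarrow> ('a \<Rightarrow> complex) \<Rightarrow> ('a \<Rightarrow> complex) \<Rightarrow> 'a \<Rightarrow> complex" where
  "shear u v z = (\<lambda>i. z i + z u * v i)"

lemma shear_inverse:
  assumes "v u = 0"
  shows "shear u (\<lambda>i. - v i) (shear u v z) = z" "shear u v (shear u (\<lambda>i. - v i) z) = z"
  using assms by (auto simp: shear_def)

lemma polyfun_shear:
  "polyfun S f \<Longrightarrow> u \<in> S \<Longrightarrow> polyfun S (\<lambda>z. f (shear u v z))"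
  by (erule polyfun_compose) (auto simp: shear_def intro!: polyfun_intros)

text \<open>The top homogeneous part of \<open>b\<close>, evaluated at a vector \<open>w\<close>, is the leading coefficient of \<open>b\<close>
  on each line in the direction \<open>w\<close>. It suffices to choose \<open>w\<close> where this does not vanish.\<close>

lemma monic_shear:
  assumes b: "polyfun S b" and nz: "b a \<noteq> 0" and "S \<noteq> {}"
  obtains u v P d c where "u \<in> S" "v u = 0" "\<forall>i. i \<notin> S \<longrightarrow> v i = 0" "polyc (S - {u}) P"
    "\<forall>z. degree (P z) = d" "\<forall>z. lead_coeff (P z) = 1" "c \<noteq> 0"
    "\<forall>z. b (shear u v z) = c * poly (P z) (z u)"
proof -
  have "\<exists>P. polyc S P \<and> (\<forall>z t. b (\<lambda>i. 0 + t * z i) = poly (P z) t)"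
    by (rule polyfun_affine[OF b, of S "\<lambda>_ _. 0" "\<lambda>z. z"]) (auto intro: polyfun.intros)
  then obtain P where P: "polyc S P" "\<And>z t. b (\<lambda>i. t * z i) = poly (P z) t" by auto
  \<comment> \<open>On lines through the origin the coefficient at \<open>t ^ n\<close> is the
    homogeneous part of \<open>b\<close> of degree \<open>n\<close>.\<close>
  define h where "h n z = coeff (P z) n" for n z
  have h: "polyfun S (h n)" for n unfolding h_def by (rule polyc_coeff[OF P(1)])
  have hom: "h n (\<lambda>i. c * z i) = c ^ n * h n z" for n c z
  proof -
    have "poly (P (\<lambda>i. c * z i)) t = poly (P z \<circ>\<^sub>p [:0, c:]) t" for t
      using P(2)[of t "\<lambda>i. c * z i"] P(2)[of "t * c" z] by (simp add: poly_pcompose mult.assoc)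
    then have "P (\<lambda>i. c * z i) = P z \<circ>\<^sub>p [:0, c:]" by (intro poly_eqI_punctured)
    then show ?thesis by (simp add: h_def coeff_pcompose_linear)
  qed
  obtain N where N: "\<And>z. degree (P z) \<le> N" using polyc_degree[OF P(1)] by blast
  have "poly (P a) 1 \<noteq> 0" using P(2)[of 1 a] nz by simp
  then have "P a \<noteq> 0" by auto
  then have ex: "\<exists>z. h (degree (P a)) z \<noteq> 0" unfolding h_def using leading_coeff_neq_0 by blast
  have bd: "n \<le> N" if nz: "\<exists>z. h n z \<noteq> 0" for n
  proof -
    obtain z where "coeff (P z) n \<noteq> 0" using nz unfolding h_def by blast
    then show ?thesis using N[of z] le_degree[of "P z" n] by simp
  qed
  \<comment> \<open>The total degree of \<open>b\<close>.\<close>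
  define D where "D = Max {n. \<exists>z. h n z \<noteq> 0}"
  have "{n. \<exists>z. h n z \<noteq> 0} \<subseteq> {..N}" using bd by blast
  then have fin: "finite {n. \<exists>z. h n z \<noteq> 0}" by (rule finite_subset) simp
  have D: "\<exists>z. h D z \<noteq> 0" using Max_in[OF fin] ex unfolding D_def by blast
  have Dmax: "n \<le> D" if "\<exists>z. h n z \<noteq> 0" for n
    unfolding D_def using that by (intro Max_ge[OF fin]) blast
  \<comment> \<open>The direction needs a nonzero coordinate in \<open>S\<close> that can be scaled
    to 1. A homogeneous part of positive degree vanishes at vectors that are zero on
    \<open>S\<close>; in degree 0 it is constant, and the vector of ones serves.\<close>
  have "\<exists>u\<in>S. \<exists>v. v u \<noteq> 0 \<and> h D v \<noteq> 0"
  proof (cases "D = 0")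
    case True
    obtain v where "h D v \<noteq> 0" using D by blast
    then have "h D (\<lambda>i. 1) \<noteq> 0"
      using hom[of D 0 v] hom[of D 0 "\<lambda>i. 1"] True by simp
    then show ?thesis using \<open>S \<noteq> {}\<close> by (metis ex_in_conv zero_neq_one)
  next
    case False
    obtain v where v: "h D v \<noteq> 0" using D by blast
    have "\<exists>u\<in>S. v u \<noteq> 0"
    proof (rule ccontr)
      assume "\<not> ?thesis"
      then have "h D v = h D (\<lambda>i. 0 * v i)" by (intro polyfun_cong[OF h]) auto
      then show False using hom[of D 0 v] False v by (simp add: power_0_left)
    qed
    then show ?thesis using v by blast
  qed
  then obtain u w0 where u: "u \<in> S" "w0 u \<noteq> 0" "h D w0 \<noteq> 0" by blast
  define w where "w i = (if i \<in> S then (1 / w0 u) * w0 i else 0)" for i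
  define v where "v = w(u := 0)"
  have w: "w u = 1" using u by (simp add: w_def)
  have "h D w = h D (\<lambda>i. (1 / w0 u) * w0 i)"
    by (intro polyfun_cong[OF h]) (auto simp: w_def)
  then have hw: "h D w \<noteq> 0" using hom[of D "1 / w0 u" w0] u by simp
  have sh: "shear u v z = (\<lambda>i. (z(u := 0)) i + z u * w i)" for z
    by (auto simp: shear_def v_def w)
  have "\<exists>B. polyc (S - {u}) B \<and> (\<forall>z t. b (\<lambda>i. (z(u := 0)) i + t * w i) = poly (B z) t)"
  proof (rule polyfun_affine[OF b])
    fix i assume "i \<in> S"
    then show "polyfun (S - {u}) (\<lambda>z. (z(u := 0)) i)"
      by (cases "i = u") (auto intro: polyfun.intros)
  qed (rule polyfun.const)
  then obtain B where B: "polyc (S - {u}) B"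
    "\<And>z t. b (\<lambda>i. (z(u := 0)) i + t * w i) = poly (B z) t" by blast
  \<comment> \<open>For \<open>t \<noteq> 0\<close> the point of the line is \<open>t\<close> times
    \<open>w + (1 / t) * z(u := 0)\<close>. The homogeneous parts thus give powers of
    \<open>t\<close> and of \<open>1 / t\<close>, and the factor \<open>t ^ e\<close> clears the
    latter. From degree \<open>e + D\<close> on, only the constant term of the part of degree
    \<open>D\<close> contributes.\<close>
  have coB: "coeff (B z) n = (if n = D then h D w else 0)" if "n \<ge> D" for z n
  proof -
    let ?z = "z(u := 0)"
    have "\<forall>n. \<exists>p. \<forall>s. h n (\<lambda>i. w i + s * ?z i) = poly p s"
      using polyfun_line[OF h] by blast
    then obtain R where R: "\<And>n s. h n (\<lambda>i. w i + s * ?z i) = poly (R n) s" by metis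
    define e where "e = Max ((\<lambda>n. degree (R n)) ` {..D})"
    have e: "degree (R n) \<le> e" if "n \<le> D" for n
      unfolding e_def using that by (intro Max_ge) auto
    have "monom 1 e * B z = (\<Sum>n\<le>D. \<Sum>j\<le>e. monom (coeff (R n) j) (n + e - j))"
    proof (rule poly_eqI_punctured)
      fix t :: complex assume t: "t \<noteq> 0"
      have "poly (B z) t = b (\<lambda>i. t * (w i + (1 / t) * ?z i))"
        using B(2)[of z t] t by (simp add: algebra_simps)
      also have "\<dots> = poly (P (\<lambda>i. w i + (1 / t) * ?z i)) t" by (rule P(2))
      also have "\<dots> = (\<Sum>n\<le>D. h n (\<lambda>i. w i + (1 / t) * ?z i) * t ^ n)"
      proof -
        have "degree (P z) \<le> D" for z
          using Dmax[of "degree (P z)"] unfolding h_def by (metis leading_coeff_0_iff degree_0 le0)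
        then show ?thesis unfolding h_def by (intro poly_altdef')
      qed
      also have "\<dots> = (\<Sum>n\<le>D. (\<Sum>j\<le>e. coeff (R n) j * (1 / t) ^ j) * t ^ n)"
        unfolding R using poly_altdef'[OF e] by (intro sum.cong) auto
      finally have "t ^ e * poly (B z) t =
          (\<Sum>n\<le>D. \<Sum>j\<le>e. t ^ e * (coeff (R n) j * (1 / t) ^ j * t ^ n))"
        by (simp add: sum_distrib_left sum_distrib_right)
      also have "\<dots> = (\<Sum>n\<le>D. \<Sum>j\<le>e. coeff (R n) j * t ^ (n + e - j))"
      proof (intro sum.cong refl)
        fix n j assume "j \<in> {..e}"
        then have "t ^ (n + e) = t ^ (n + e - j) * t ^ j" by (simp flip: power_add)
        then show "t ^ e * (coeff (R n) j * (1 / t) ^ j * t ^ n) = coeff (R n) j * t ^ (n + e - j)"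
          using t by (simp add: power_add power_divide field_simps)
      qed
      finally show "poly (monom 1 e * B z) t =
          poly (\<Sum>n\<le>D. \<Sum>j\<le>e. monom (coeff (R n) j) (n + e - j)) t"
        by (simp add: poly_sum poly_monom)
    qed
    moreover have "coeff (monom 1 e * B z) (e + n) = coeff (B z) n"
      by (simp add: coeff_monom_mult)
    ultimately have "coeff (B z) n =
        coeff (\<Sum>m\<le>D. \<Sum>j\<le>e. monom (coeff (R m) j) (m + e - j)) (e + n)" by simp
    also have "\<dots> = (\<Sum>m\<le>D. \<Sum>j\<le>e. if j = 0 then if m = D \<and> n = D then coeff (R D) 0 else 0 else 0)"
      unfolding coeff_sum using that by (intro sum.cong refl) auto
    also have "\<dots> = (\<Sum>m\<le>D. if m = D then (if n = D then coeff (R D) 0 else 0) else 0)"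
      by (intro sum.cong refl) simp
    also have "\<dots> = (if n = D then coeff (R D) 0 else 0)" by simp
    also have "coeff (R D) 0 = h D w" using R[of D 0] by (simp add: poly_0_coeff_0)
    finally show ?thesis .
  qed
  let ?Q = "\<lambda>z. smult (1 / h D w) (B z)"
  have deg: "degree (?Q z) = D" "lead_coeff (?Q z) = 1" for z
  proof -
    have "degree (?Q z) \<le> D" using coB by (intro degree_le) auto
    moreover have 1: "coeff (?Q z) D = 1" using coB[of D z] hw by simp
    then have "D \<le> degree (?Q z)" by (intro le_degree) simp
    ultimately show "degree (?Q z) = D" by simp
    then show "lead_coeff (?Q z) = 1" using 1 by simp
  qed
  show ?thesis
  proof (rule that)
    show "\<forall>z. b (shear u v z) = h D w * poly (?Q z) (z u)"
      unfolding sh B(2) using hw by simp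
    show "polyc (S - {u}) ?Q" by (intro polyc_smult polyfun.const B)
  qed (use u(1) hw deg in \<open>auto simp: v_def w_def\<close>)
qed

section \<open>Noetherianity\<close>

definition ideal_on :: "'a set \<Rightarrow> (('a \<Rightarrow> complex) \<Rightarrow> complex) set \<Rightarrow> bool" where
  "ideal_on S I \<longleftrightarrow> (\<forall>f\<in>I. polyfun S f) \<and> (\<lambda>z. 0) \<in> I \<and>
     (\<forall>f\<in>I. \<forall>g\<in>I. (\<lambda>z. f z + g z) \<in> I) \<and>
     (\<forall>f\<in>I. \<forall>g. polyfun S g \<longrightarrow> (\<lambda>z. g z * f z) \<in> I)"

lemma ideal_on_polyfun: "ideal_on S I \<Longrightarrow> f \<in> I \<Longrightarrow> polyfun S f"
  unfolding ideal_on_def by blast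

lemma ideal_on_add: "ideal_on S I \<Longrightarrow> f \<in> I \<Longrightarrow> g \<in> I \<Longrightarrow> (\<lambda>z. f z + g z) \<in> I"
  unfolding ideal_on_def by blast

lemma ideal_on_mult: "ideal_on S I \<Longrightarrow> f \<in> I \<Longrightarrow> polyfun S g \<Longrightarrow> (\<lambda>z. g z * f z) \<in> I"
  unfolding ideal_on_def by blast

lemma ideal_on_0: "ideal_on S I \<Longrightarrow> (\<lambda>z. 0) \<in> I"
  unfolding ideal_on_def by blast

lemma ideal_on_diff:
  assumes "ideal_on S I" "f \<in> I" "g \<in> I" shows "(\<lambda>z. f z - g z) \<in> I"
  using ideal_on_add[OF assms(1,2) ideal_on_mult[OF assms(1,3) polyfun.const[of S "-1"]]] by simp

text \<open>Degree at most \<open>d\<close>, instead of exactly \<open>d\<close>, admits the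
  coefficient 0 and so gives an ideal; it also makes the ideals grow with \<open>d\<close>.\<close>

definition lead_ideal ::
  "'a set \<Rightarrow> 'a \<Rightarrow> (('a \<Rightarrow> complex) \<Rightarrow> complex) set \<Rightarrow> nat \<Rightarrow> (('a \<Rightarrow> complex) \<Rightarrow> complex) set"
  where "lead_ideal S s I d = {c. \<exists>P. polyc S P \<and> (\<forall>z. degree (P z) \<le> d) \<and>
     (\<lambda>z. poly (P z) (z s)) \<in> I \<and> c = (\<lambda>z. coeff (P z) d)}"

lemma ideal_lead_ideal:
  assumes I: "ideal_on (insert s S) I"
  shows "ideal_on S (lead_ideal S s I d)"
  unfolding ideal_on_def
proof (intro conjI ballI allI impI)
  fix c assume "c \<in> lead_ideal S s I d"
  then show "polyfun S c" unfolding lead_ideal_def by (auto intro: polyc_coeff)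
next
  show "(\<lambda>z. 0) \<in> lead_ideal S s I d" unfolding lead_ideal_def
    by (rule CollectI, rule exI[of _ "\<lambda>z. 0"]) (auto intro: polyc_const ideal_on_0[OF I])
next
  fix c e assume "c \<in> lead_ideal S s I d" "e \<in> lead_ideal S s I d"
  then obtain P Q where "polyc S P" "\<And>z. degree (P z) \<le> d" "(\<lambda>z. poly (P z) (z s)) \<in> I"
    "c = (\<lambda>z. coeff (P z) d)" "polyc S Q" "\<And>z. degree (Q z) \<le> d" "(\<lambda>z. poly (Q z) (z s)) \<in> I"
    "e = (\<lambda>z. coeff (Q z) d)" unfolding lead_ideal_def by blast
  then show "(\<lambda>z. c z + e z) \<in> lead_ideal S s I d" unfolding lead_ideal_def
    using ideal_on_add[OF I, of "\<lambda>z. poly (P z) (z s)" "\<lambda>z. poly (Q z) (z s)"]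
    by (intro CollectI exI[of _ "\<lambda>z. P z + Q z"]) (auto intro: polyc_add degree_add_le)
next
  fix c g assume "c \<in> lead_ideal S s I d" and g: "polyfun S g"
  then obtain P where P: "polyc S P" "\<And>z. degree (P z) \<le> d" "(\<lambda>z. poly (P z) (z s)) \<in> I"
    "c = (\<lambda>z. coeff (P z) d)" unfolding lead_ideal_def by blast
  have "(\<lambda>z. g z * poly (P z) (z s)) \<in> I"
    using ideal_on_mult[OF I P(3)] polyfun_mono[OF g] by blast
  moreover have "degree (smult (g z) (P z)) \<le> d" for z
    using P(2) degree_smult_le le_trans by blast
  ultimately show "(\<lambda>z. g z * c z) \<in> lead_ideal S s I d" unfolding lead_ideal_def
    using P g by (intro CollectI exI[of _ "\<lambda>z. smult (g z) (P z)"]) (auto intro: polyc_smult)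
qed

lemma lead_ideal_mono: "I \<subseteq> J \<Longrightarrow> lead_ideal S s I d \<subseteq> lead_ideal S s J d"
  unfolding lead_ideal_def by blast

lemma lead_ideal_Suc:
  assumes I: "ideal_on (insert s S) I"
  shows "lead_ideal S s I d \<subseteq> lead_ideal S s I (Suc d)"
proof
  fix c assume "c \<in> lead_ideal S s I d"
  then obtain P where P: "polyc S P" "\<And>z. degree (P z) \<le> d" "(\<lambda>z. poly (P z) (z s)) \<in> I"
    "c = (\<lambda>z. coeff (P z) d)" unfolding lead_ideal_def by blast
  have "(\<lambda>z. z s * poly (P z) (z s)) \<in> I"
    using ideal_on_mult[OF I P(3), of "\<lambda>z. z s"] by (auto intro: polyfun.coord)
  moreover have "polyc S (\<lambda>z. [:0, 1:] * P z)" using P by (intro polyc_mult polyc_const)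
  moreover have "degree (pCons 0 (P z)) \<le> Suc d" for z
    using le_trans[OF degree_pCons_le] P(2)[of z] by simp
  ultimately show "c \<in> lead_ideal S s I (Suc d)" unfolding lead_ideal_def
    using P by (intro CollectI exI[of _ "\<lambda>z. pCons 0 (P z)"]) auto
qed

lemma lead_ideal_mono2:
  assumes I: "ideal_on (insert s S) I" and "d \<le> e"
  shows "lead_ideal S s I d \<subseteq> lead_ideal S s I e"
  using \<open>d \<le> e\<close> by (rule lift_Suc_mono_le[of "lead_ideal S s I", OF lead_ideal_Suc[OF I]])

text \<open>Subtracting from a member of \<open>J\<close> a member of \<open>I\<close> with the same
  coefficient at the degree bound lowers that bound, and the difference is again in
  \<open>J\<close>.\<close>

lemma ideal_eqI_lead_ideal:
  assumes I: "ideal_on (insert s S) I" and J: "ideal_on (insert s S) J" and "I \<subseteq> J" "s \<notin> S"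
    and eq: "\<And>d. lead_ideal S s J d \<subseteq> lead_ideal S s I d"
  shows "I = J"
proof -
  have *: "(\<lambda>z. poly (P z) (z s)) \<in> I"
    if "polyc S P" "(\<lambda>z. poly (P z) (z s)) \<in> J" "\<And>z. degree (P z) \<le> d" for P d
    using that
  proof (induction d arbitrary: P rule: less_induct)
    case (less d)
    have "(\<lambda>z. coeff (P z) d) \<in> lead_ideal S s J d"
      unfolding lead_ideal_def using less by blast
    then obtain Q where Q: "polyc S Q" "\<And>z. degree (Q z) \<le> d" "(\<lambda>z. poly (Q z) (z s)) \<in> I"
      "(\<lambda>z. coeff (P z) d) = (\<lambda>z. coeff (Q z) d)" using eq unfolding lead_ideal_def by blast
    have R: "(\<lambda>z. poly (P z - Q z) (z s)) \<in> J"
      using ideal_on_diff[OF J less(3), of "\<lambda>z. poly (Q z) (z s)"] Q \<open>I \<subseteq> J\<close> by auto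
    have co: "coeff (P z - Q z) n = 0" if "n \<ge> d" for z n
    proof (cases "n = d")
      case True
      then show ?thesis using fun_cong[OF Q(4), of z] by simp
    next
      case False
      then have "degree (P z) < n" "degree (Q z) < n"
        using that Q(2)[of z] less(4)[of z] by linarith+
      then show ?thesis by (simp add: coeff_eq_0)
    qed
    have "(\<lambda>z. poly (P z - Q z) (z s)) \<in> I"
    proof (cases d)
      case 0
      then have "P z - Q z = 0" for z using co by (intro poly_eqI) simp
      then show ?thesis using ideal_on_0[OF I] by simp
    next
      case (Suc n)
      then have "degree (P z - Q z) \<le> n" for z using co by (intro degree_le) auto
      then show ?thesis using less(1)[of n "\<lambda>z. P z - Q z"] R less(2) Q Suc
        by (auto intro: polyc_diff)
    qed
    from ideal_on_add[OF I this Q(3)] show ?case by simp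
  qed
  have "J \<subseteq> I"
  proof
    fix f assume f: "f \<in> J"
    obtain P where P: "polyc S P" "\<And>z. f z = poly (P z) (z s)"
      using polyfun_in_coord[OF ideal_on_polyfun[OF J f] \<open>s \<notin> S\<close>] by blast
    then have eq: "f = (\<lambda>z. poly (P z) (z s))" by blast
    obtain d where d: "\<And>z. degree (P z) \<le> d" using polyc_degree[OF P(1)] by blast
    show "f \<in> I" using *[OF P(1) _ d] f unfolding eq by simp
  qed
  then show ?thesis using \<open>I \<subseteq> J\<close> by blast
qed

text \<open>The leading ideals increase in both indices. The diagonal is constant from
  \<open>N\<close> on, which controls all degrees above \<open>N\<close>; the finitely many degrees
  up to \<open>N\<close> become constant separately, and \<open>K\<close> lies beyond all these
  indices.\<close>

theorem hilbert_basis: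
  assumes "finite S" "\<And>n. ideal_on S (I n)" "\<And>n. I n \<subseteq> I (Suc n)"
  shows "\<exists>N. \<forall>n\<ge>N. I n = I N"
  using assms
proof (induction S arbitrary: I rule: finite_induct)
  case empty
  have mono: "I m \<subseteq> I n" if "m \<le> n" for m n using that lift_Suc_mono_le[of I] empty(2) by blast
  show ?case
  proof (cases "\<exists>N f. f \<in> I N \<and> f \<noteq> (\<lambda>z. 0)")
    \<comment> \<open>Without variables a nonzero polynomial function is a nonzero constant, so an
      ideal that contains one contains everything.\<close>
    case True
    then obtain N f a where f: "f \<in> I N" "f a \<noteq> 0" by blast
    have c: "g z = g a" if "polyfun {} g" for g :: "('a \<Rightarrow> complex) \<Rightarrow> complex" and z
      by (rule polyfun_cong[OF that]) auto
    have "g \<in> I N" if "polyfun {} g" for g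
    proof -
      have "(\<lambda>z. (g z / f a) * f z) \<in> I N"
        using ideal_on_mult[OF empty(1) f(1), of "\<lambda>z. g z / f a"]
          polyfun.mult[OF that polyfun.const[of _ "1 / f a"]]
        by simp
      moreover have "(\<lambda>z. (g z / f a) * f z) = g"
        using c[OF ideal_on_polyfun[OF empty(1) f(1)]] f(2)
        by (intro ext) (metis nonzero_eq_divide_eq times_divide_eq_left)
      ultimately show ?thesis by simp
    qed
    then show ?thesis using mono ideal_on_polyfun[OF empty(1)] by blast
  next
    case False
    then have "I n = {\<lambda>z. 0}" for n using ideal_on_0[OF empty(1)] by blast
    then show ?thesis by simp
  qed
next
  case (insert s S)
  have mono: "I m \<subseteq> I n" if "m \<le> n" for m n using that lift_Suc_mono_le[of I] insert(5) by blast
  let ?L = "\<lambda>n. lead_ideal S s (I n)"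
  have L: "?L m d \<subseteq> ?L n e" if "m \<le> n" "d \<le> e" for m n d e
    using lead_ideal_mono[OF mono[OF that(1)]] lead_ideal_mono2[OF insert(4) that(2)] by blast
  have id: "ideal_on S (?L n d)" for n d by (rule ideal_lead_ideal[OF insert(4)])
  obtain N where N: "\<And>n. n \<ge> N \<Longrightarrow> ?L n n = ?L N N"
    using insert(3)[of "\<lambda>n. ?L n n"] id L[OF le_SucI le_SucI] by blast
  have "\<forall>d. \<exists>M. \<forall>n\<ge>M. ?L n d = ?L M d"
    using insert(3)[of "\<lambda>n. ?L n _"] id L[OF le_SucI] by blast
  then obtain M where M: "\<And>d n. n \<ge> M d \<Longrightarrow> ?L n d = ?L (M d) d" by metis
  define K where "K = Max (insert N (M ` {..N}))"
  have K: "N \<le> K" "\<And>d. d \<le> N \<Longrightarrow> M d \<le> K"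
    unfolding K_def by (auto intro!: Max_ge simp del: Max_insert)
  have "?L n d \<subseteq> ?L K d" if "n \<ge> K" for n d
  proof (cases "d \<le> N")
    case True
    then have "?L n d = ?L (M d) d" "?L K d = ?L (M d) d"
      using M K that by (meson le_trans order_refl)+
    then show ?thesis by simp
  next
    case False
    have "?L n d \<subseteq> ?L (max n d) (max n d)" by (rule L) auto
    also have "\<dots> = ?L N N" using that K by (intro N) auto
    also have "\<dots> \<subseteq> ?L K d" using K False by (intro L) auto
    finally show ?thesis .
  qed
  then have "I K = I n" if "n \<ge> K" for n
    using that insert(2,4) mono by (intro ideal_eqI_lead_ideal[of s S]) auto
  then show ?case by metis
qed

text \<open>The coordinates outside \<open>S\<close> are free, so that algebraic sets of different dimensions live in
  one type, as cylinders.\<close>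

definition alg_on :: "'a set \<Rightarrow> ('a \<Rightarrow> complex) set \<Rightarrow> bool" where
  "alg_on S X \<longleftrightarrow> (\<exists>F. (\<forall>f\<in>F. polyfun S f) \<and> X = {z. \<forall>f\<in>F. f z = 0})"

definition vanishing :: "'a set \<Rightarrow> ('a \<Rightarrow> complex) set \<Rightarrow> (('a \<Rightarrow> complex) \<Rightarrow> complex) set" where
  "vanishing S X = {f. polyfun S f \<and> (\<forall>z\<in>X. f z = 0)}"

lemma ideal_vanishing: "ideal_on S (vanishing S X)"
  unfolding ideal_on_def vanishing_def by (auto intro: polyfun_intros)

lemma alg_on_vanishing: "alg_on S X \<Longrightarrow> X = {z. \<forall>f\<in>vanishing S X. f z = 0}"
  unfolding alg_on_def vanishing_def by blast

lemma alg_onI: "(\<And>f. f \<in> F \<Longrightarrow> polyfun S f) \<Longrightarrow> alg_on S {z. \<forall>f\<in>F. f z = 0}"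
  unfolding alg_on_def by blast

lemma alg_on_Int:
  assumes "alg_on S X" "alg_on S Y" shows "alg_on S (X \<inter> Y)"
proof -
  obtain F G where "\<forall>f\<in>F \<union> G. polyfun S f" "X = {z. \<forall>f\<in>F. f z = 0}" "Y = {z. \<forall>f\<in>G. f z = 0}"
    using assms unfolding alg_on_def by blast
  then show ?thesis unfolding alg_on_def by (intro exI[of _ "F \<union> G"]) auto
qed

lemma alg_on_zeros: "polyfun S f \<Longrightarrow> alg_on S {z. f z = 0}"
  using alg_onI[of "{f}" S] by simp

lemma alg_on_compose:
  assumes "alg_on S X" "\<And>i. i \<in> S \<Longrightarrow> polyfun T (\<lambda>z. g z i)"
  shows "alg_on T {z. g z \<in> X}"
proof -
  obtain F where F: "\<forall>f\<in>F. polyfun S f" "X = {z. \<forall>f\<in>F. f z = 0}"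
    using assms(1) unfolding alg_on_def by blast
  have "polyfun T (\<lambda>z. f (g z))" if "f \<in> F" for f
    using F(1) that assms(2) by (intro polyfun_compose[of S f T g]) auto
  then have "alg_on T {z. \<forall>h\<in>(\<lambda>f z. f (g z)) ` F. h z = 0}"
    by (intro alg_onI) (auto simp only: image_iff)
  then show ?thesis unfolding F(2) by simp
qed

text \<open>A strictly descending chain would give an ascending chain of vanishing ideals, and an
  algebraic set is determined by its vanishing ideal. This is the form in which the basis theorem is
  used: Noetherian induction over algebraic sets.\<close>

lemma wf_alg_on:
  assumes "finite S" shows "wf {(X, Y). alg_on S X \<and> alg_on S Y \<and> X \<subset> Y}"
  unfolding wf_iff_no_infinite_down_chain
proof
  assume "\<exists>Z. \<forall>n. (Z (Suc n), Z n) \<in> {(X, Y). alg_on S X \<and> alg_on S Y \<and> X \<subset> Y}"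
  then obtain Z where "\<forall>n. (Z (Suc n), Z n) \<in> {(X, Y). alg_on S X \<and> alg_on S Y \<and> X \<subset> Y}"
    by (rule exE)
  then have Z: "alg_on S (Z n)" "Z (Suc n) \<subset> Z n" for n by auto
  have "vanishing S (Z n) \<subseteq> vanishing S (Z (Suc n))" for n
    using Z(2)[of n] by (auto simp: vanishing_def)
  then have "\<exists>N. \<forall>n\<ge>N. vanishing S (Z n) = vanishing S (Z N)"
    by (rule hilbert_basis[of S "\<lambda>n. vanishing S (Z n)", OF assms ideal_vanishing])
  then obtain N where "\<forall>n\<ge>N. vanishing S (Z n) = vanishing S (Z N)" by (rule exE)
  then have "vanishing S (Z (Suc N)) = vanishing S (Z N)" by (meson le_SucI order_refl)
  then have "Z (Suc N) = Z N"
    by (subst (1 2) alg_on_vanishing[OF Z(1)]) simp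
  then show False using Z(2)[of N] by simp
qed

section \<open>Elimination of a variable\<close>

text \<open>The generators are removed one by one instead of through a determinant: the last
  equation is solved for \<open>e d\<close> after multiplication by \<open>1 - m d d\<close>, which
  has the value 1 at \<open>a\<close>.\<close>

lemma nakayama:
  fixes m :: "nat \<Rightarrow> nat \<Rightarrow> ('a \<Rightarrow> complex) \<Rightarrow> complex"
  assumes "\<And>i j. i < d \<Longrightarrow> j < d \<Longrightarrow> polyfun S (m i j)"
    and "\<And>i j. i < d \<Longrightarrow> j < d \<Longrightarrow> m i j a = 0"
    and "\<And>z i. z \<in> X \<Longrightarrow> i < d \<Longrightarrow> e i z = (\<Sum>j<d. m i j z * e j z)"
  shows "\<exists>g. polyfun S g \<and> g a = 1 \<and> (\<forall>z\<in>X. \<forall>i<d. g z * e i z = 0)"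
  using assms
proof (induction d arbitrary: m)
  case 0
  show ?case by (rule exI[of _ "\<lambda>z. 1"]) (auto intro: polyfun.const)
next
  case (Suc d)
  define u where "u z = 1 - m d d z" for z
  \<comment> \<open>Equation \<open>i\<close> is multiplied by \<open>u\<close>, the last equation
    is substituted for \<open>u * e d\<close>, and \<open>m d d * e i\<close> is added on both
    sides, so that \<open>e i\<close> again has coefficient 1.\<close>
  define m' where "m' i j z = u z * m i j z + m i d z * m d j z + (if i = j then m d d z else 0)"
    for i j z
  have u: "polyfun S u" unfolding u_def using Suc(2) by (intro polyfun_intros) auto
  have ud: "u z * e d z = (\<Sum>j<d. m d j z * e j z)" if "z \<in> X" for z
    using Suc(4)[OF that, of d] by (simp add: u_def algebra_simps)
  have "polyfun S (m' i j)" if "i < d" "j < d" for i j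
  proof -
    have "polyfun S (\<lambda>z. if i = j then m d d z else 0)"
      using Suc(2) by (cases "i = j") (auto intro: polyfun.const)
    then show ?thesis unfolding m'_def using that Suc(2) u by (intro polyfun_intros) auto
  qed
  moreover have "m' i j a = 0" if "i < d" "j < d" for i j
    using that Suc(3) unfolding m'_def by auto
  moreover have "e i z = (\<Sum>j<d. m' i j z * e j z)" if "z \<in> X" "i < d" for z i
  proof -
    have "(\<Sum>j<d. (if i = j then m d d z else 0) * e j z) = (\<Sum>j<d. if j = i then m d d z * e i z else 0)"
      by (intro sum.cong) auto
    also have "\<dots> = m d d z * e i z" using that by simp
    finally have "(\<Sum>j<d. m' i j z * e j z) =
        u z * (\<Sum>j<d. m i j z * e j z) + m i d z * (u z * e d z) + m d d z * e i z"
      unfolding ud[OF that(1)]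
      by (simp add: m'_def algebra_simps sum.distrib sum_distrib_left)
    also have "\<dots> = u z * e i z + m d d z * e i z"
      using Suc(4)[OF that(1), of i] that(2) by (simp add: algebra_simps)
    also have "\<dots> = e i z" by (simp add: u_def algebra_simps)
    finally show ?thesis by simp
  qed
  ultimately obtain g where g: "polyfun S g" "g a = 1" "\<And>z i. z \<in> X \<Longrightarrow> i < d \<Longrightarrow> g z * e i z = 0"
    using Suc(1)[of m'] by blast
  have "g z * u z * e i z = 0" if "z \<in> X" "i < Suc d" for z i
  proof (cases "i = d")
    case True
    have "g z * (u z * e d z) = (\<Sum>j<d. m d j z * (g z * e j z))"
      unfolding ud[OF that(1)] by (simp add: sum_distrib_left algebra_simps)
    then show ?thesis using True g(3)[OF that(1)] by (simp add: mult.assoc)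
  next
    case False
    then show ?thesis using that g(3)[OF that(1), of i] by auto
  qed
  moreover have "g a * u a = 1" using g(2) Suc(3) by (simp add: u_def)
  ultimately show ?case using polyfun.mult[OF g(1) u] by blast
qed

text \<open>A point \<open>a\<close> outside the image is separated from it: some polynomial that vanishes on \<open>X\<close>
  restricts to \<open>1\<close> on the fibre over \<open>a\<close>, so multiplication by it on the powers of the eliminated
  coordinate is the identity modulo the functions vanishing at \<open>a\<close>.\<close>

lemma alg_on_eliminate:
  assumes X: "alg_on (insert s S) X" and s: "s \<notin> S" and F: "polyc S F"
    and monic: "\<And>z. degree (F z) = d" "\<And>z. lead_coeff (F z) = 1"
    and FX: "\<And>z. z \<in> X \<Longrightarrow> poly (F z) (z s) = 0"
  shows "alg_on S {z. \<exists>c. z(s := c) \<in> X}"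
proof -
  let ?Y = "{z. \<exists>c. z(s := c) \<in> X}"
  let ?I = "vanishing (insert s S) X"
  have sep: "\<exists>g\<in>vanishing S ?Y. g a \<noteq> 0" if a: "a \<notin> ?Y" for a
  proof -
    \<comment> \<open>The restrictions to the fibre over \<open>a\<close> of the polynomials that
      vanish on \<open>X\<close>. A nonzero member of least degree divides all of them, so a root of
      it would be a point of \<open>X\<close> over \<open>a\<close>; hence it is a constant.\<close>
    define J where "J = {p. \<exists>P. polyc S P \<and> (\<forall>z\<in>X. poly (P z) (z s) = 0) \<and> p = P a}"
    have J: "(\<forall>z\<in>X. poly (P z) (z s) = 0) \<Longrightarrow> polyc S P \<Longrightarrow> P a \<in> J" for P
      unfolding J_def by blast
    have "F a \<in> J" "F a \<noteq> 0" using J F FX monic(2)[of a] by auto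
    then obtain q where q: "q \<in> J" "q \<noteq> 0" and qmin: "\<And>p. p \<in> J \<Longrightarrow> p \<noteq> 0 \<Longrightarrow> degree q \<le> degree p"
      using ex_has_least_nat[of "\<lambda>p. p \<in> J \<and> p \<noteq> 0" "F a" degree] by blast
    obtain Q where Q: "polyc S Q" "\<And>z. z \<in> X \<Longrightarrow> poly (Q z) (z s) = 0" "q = Q a"
      using q(1) unfolding J_def by blast
    have "degree q = 0"
    proof (rule ccontr)
      assume "degree q \<noteq> 0"
      then obtain c where c: "poly q c = 0"
        using fundamental_theorem_of_algebra constant_degree by metis
      have "f (a(s := c)) = 0" if f: "f \<in> ?I" for f
      proof -
        obtain P where P: "polyc S P" "\<And>z t. f (z(s := t)) = poly (P z) t"
          "\<And>z. f z = poly (P z) (z s)"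
          using polyfun_in_coord[OF _ s, of f] f unfolding vanishing_def by blast
        have "P a - Q a * (P a div q) \<in> J"
          using P Q f by (intro J[of "\<lambda>z. P z - Q z * (P a div q)"])
            (auto simp: vanishing_def intro!: polyc_diff polyc_mult polyc_const)
        then have "P a mod q \<in> J" unfolding Q(3)[symmetric]
          by (simp add: minus_mult_div_eq_mod)
        then have "P a mod q = 0"
          using qmin[of "P a mod q"] degree_mod_less'[OF q(2), of "P a"] by linarith
        then have "q dvd P a" by auto
        then show ?thesis using c unfolding P(2) by (auto elim: dvdE)
      qed
      then have "a(s := c) \<in> X" using alg_on_vanishing[OF X] by blast
      then show False using a by blast
    qed
    then obtain k where k: "q = [:k:]" using degree_eq_zeroE by blast
    then have "k \<noteq> 0" using q by auto
    define H where "H z = smult (1 / k) (Q z)" for z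
    have H: "polyc S H" "\<And>z. z \<in> X \<Longrightarrow> poly (H z) (z s) = 0"
      using Q(1,2) unfolding H_def by (auto intro: polyc_smult polyfun.const)
    have Ha: "H a = 1" unfolding H_def Q(3)[symmetric] k using \<open>k \<noteq> 0\<close> by (simp add: one_pCons)
    show ?thesis
    proof (cases "d = 0")
      case True
      then have "F z = 1" for z using monic[of z] by (metis degree_eq_zeroE lead_coeff_pCons(2) one_pCons)
      then have "X = {}" using FX by auto
      then show ?thesis unfolding vanishing_def
        by (intro bexI[of _ "\<lambda>z. 1"]) (auto intro: polyfun.const)
    next
      case False
      \<comment> \<open>\<open>R i\<close> vanishes on \<open>X\<close> because \<open>H\<close> and
        \<open>F\<close> do, and at \<open>a\<close>, where \<open>H\<close> is 1, it is the
        monomial of degree \<open>i\<close>. Hence the matrix \<open>m\<close> of the identity minus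
        the coefficients of \<open>R\<close> vanishes at \<open>a\<close>.\<close>
      define R where "R i z = (monom 1 i * H z) mod F z" for i z
      define m where "m i j z = (if i = j then 1 else 0) - coeff (R i z) j" for i j z
      have F0: "F z \<noteq> 0" for z using monic(2)[of z] by auto
      have R: "polyc S (R i)" for i
        unfolding R_def by (intro polyc_divmod_monic(2)[OF _ F monic] polyc_mult polyc_const H)
      have Ra: "R i a = monom 1 i" if "i < d" for i
        unfolding R_def using Ha that monic(1)
        by (simp add: mod_poly_less degree_monom_eq)
      have RX: "poly (R i z) (z s) = 0" if "z \<in> X" for i z
        unfolding R_def minus_div_mult_eq_mod[symmetric] using FX[OF that] H(2)[OF that] by simp
      have degR: "degree (R i z) \<le> d - 1" for i z
        unfolding R_def using degree_mod_less'[OF F0, of "monom 1 i * H z" z] monic(1)[of z] False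
        by (cases "monom 1 i * H z mod F z = 0") auto
      have "\<exists>g. polyfun S g \<and> g a = 1 \<and> (\<forall>z\<in>X. \<forall>i<d. g z * z s ^ i = 0)"
      proof (rule nakayama[where m = m and e = "\<lambda>i z. z s ^ i"])
        fix i j assume "i < d" "j < d"
        show "polyfun S (m i j)"
          unfolding m_def by (intro polyfun_diff polyfun.const polyc_coeff[OF R])
        show "m i j a = 0" unfolding m_def Ra[OF \<open>i < d\<close>] by simp
      next
        fix z i assume z: "z \<in> X" and i: "i < d"
        have "(\<Sum>j<d. m i j z * z s ^ j) =
           (\<Sum>j<d. if i = j then z s ^ j else 0) - (\<Sum>j<d. coeff (R i z) j * z s ^ j)"
          unfolding m_def sum_subtractf[symmetric]
          by (intro sum.cong) (auto simp: algebra_simps)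
        also have "(\<Sum>j<d. coeff (R i z) j * z s ^ j) = poly (R i z) (z s)"
          unfolding poly_altdef'[OF degR] using False by (intro sum.cong) auto
        finally show "z s ^ i = (\<Sum>j<d. m i j z * z s ^ j)" using RX[OF z] i by simp
      qed
      \<comment> \<open>Exponent 0, available since \<open>d\<close> is not 0, says that
        \<open>g\<close> itself vanishes on \<open>X\<close>.\<close>
      then obtain g where g: "polyfun S g" "g a = 1" "\<And>z. z \<in> X \<Longrightarrow> g z = 0"
        using False by (metis mult_1_right neq0_conv power_0)
      have "g z = 0" if "z(s := c) \<in> X" for z c
      proof -
        have "g z = g (z(s := c))" using s by (intro polyfun_cong[OF g(1)]) auto
        then show ?thesis using g(3)[OF that] by simp
      qed
      then show ?thesis using g(1,2) unfolding vanishing_def by (intro bexI[of _ g]) auto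
    qed
  qed
  have "?Y = {z. \<forall>f\<in>vanishing S ?Y. f z = 0}"
  proof
    show "?Y \<subseteq> {z. \<forall>f\<in>vanishing S ?Y. f z = 0}" by (auto simp: vanishing_def)
    show "{z. \<forall>f\<in>vanishing S ?Y. f z = 0} \<subseteq> ?Y" using sep by blast
  qed
  moreover have "alg_on S {z. \<forall>f\<in>vanishing S ?Y. f z = 0}"
    by (intro alg_onI) (auto simp: vanishing_def)
  ultimately show ?thesis by simp
qed


section \<open>Bounds on roots and divisibility\<close>

text \<open>The bound makes every root of \<open>A\<close> a root of \<open>B\<close>. After
  cancelling the common linear factor the bound persists away from the root, and at the root by
  continuity.\<close>

lemma poly_dvd_of_locally_bounded_quotient:
  fixes A B :: "complex poly"
  assumes "A \<noteq> 0" "\<And>R. \<exists>C. \<forall>t. norm t \<le> R \<longrightarrow> norm (poly B t) \<le> C * norm (poly A t)"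
  shows "A dvd B"
  using assms
proof (induction "degree A" arbitrary: A B)
  case 0
  then show ?case by (metis is_unit_iff_degree unit_imp_dvd)
next
  case (Suc n)
  obtain \<alpha> where \<alpha>: "poly A \<alpha> = 0"
    using fundamental_theorem_of_algebra constant_degree Suc(2) by (metis nat.distinct(1))
  obtain C where "\<forall>t. norm t \<le> norm \<alpha> \<longrightarrow> norm (poly B t) \<le> C * norm (poly A t)"
    using Suc(4) by blast
  then have "poly B \<alpha> = 0" using \<alpha> by force
  then obtain A' B' where AB: "A = [:- \<alpha>, 1:] * A'" "B = [:- \<alpha>, 1:] * B'"
    using \<alpha> by (meson dvdE poly_eq_0_iff_dvd)
  have A': "A' \<noteq> 0" using AB(1) Suc(3) by auto
  have "degree A = Suc (degree A')" unfolding AB(1) using A' by (subst degree_mult_eq) auto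
  then have "degree A' = n" using Suc(2) by simp
  have "\<exists>C. \<forall>t. norm t \<le> R \<longrightarrow> norm (poly B' t) \<le> C * norm (poly A' t)" for R
  proof -
    \<comment> \<open>Radius \<open>R + 1\<close> leaves room for a limit at a root of norm
      \<open>R\<close>.\<close>
    obtain C where C: "\<And>t. norm t \<le> R + 1 \<Longrightarrow> norm (poly B t) \<le> C * norm (poly A t)"
      using Suc(4) by blast
    have ne: "norm (poly B' t) \<le> C * norm (poly A' t)" if "norm t \<le> R + 1" "t \<noteq> \<alpha>" for t
    proof -
      have "norm (t - \<alpha>) * norm (poly B' t) \<le> norm (t - \<alpha>) * (C * norm (poly A' t))"
        using C[OF that(1)] unfolding AB poly_mult norm_mult by (simp add: mult_ac)
      then show ?thesis using that(2) by simp
    qed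
    have "norm (poly B' \<alpha>) \<le> C * norm (poly A' \<alpha>)" if "norm \<alpha> \<le> R"
    proof (rule tendsto_le[of "at \<alpha>" "\<lambda>t. C * norm (poly A' t)" _ "\<lambda>t. norm (poly B' t)"])
      have "((\<lambda>t. norm t) \<longlongrightarrow> norm \<alpha>) (at \<alpha>)" by (intro tendsto_intros)
      then have "\<forall>\<^sub>F t in at \<alpha>. norm t < R + 1" using that by (intro order_tendstoD) auto
      moreover have "\<forall>\<^sub>F t in at \<alpha>. t \<noteq> \<alpha>" by (simp add: eventually_at_filter)
      ultimately show "\<forall>\<^sub>F t in at \<alpha>. norm (poly B' t) \<le> C * norm (poly A' t)"
        by eventually_elim (simp add: ne)
    qed (auto intro!: tendsto_intros isContD)
    then have "norm (poly B' t) \<le> C * norm (poly A' t)" if "norm t \<le> R" for t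
      using ne[of t] that by (cases "t = \<alpha>") auto
    then show ?thesis by blast
  qed
  then have "A' dvd B'" using Suc(1)[of A' B'] \<open>degree A' = n\<close> A' by blast
  then show ?case unfolding AB by (rule mult_dvd_mono[OF dvd_refl])
qed

text \<open>Multiplication by a linear factor with root of norm at most \<open>M\<close> enlarges
  the bound on the coefficients by at most the factor \<open>1 + M\<close>.\<close>

lemma coeff_bound_of_roots:
  fixes p :: "complex poly"
  assumes "\<And>t. poly p t = 0 \<Longrightarrow> norm t \<le> M" "M \<ge> 0"
  shows "norm (coeff p i) \<le> (1 + M) ^ degree p * norm (lead_coeff p)"
  using assms
proof (induction "degree p" arbitrary: p i)
  case 0
  then obtain c where "p = [:c:]" by (metis degree_eq_zeroE)
  then show ?case by (cases i) auto
next
  case (Suc n)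
  obtain \<alpha> where \<alpha>: "poly p \<alpha> = 0"
    using fundamental_theorem_of_algebra constant_degree Suc(2) by (metis nat.distinct(1))
  then obtain q where q: "p = [:- \<alpha>, 1:] * q" by (meson dvdE poly_eq_0_iff_dvd)
  have q0: "q \<noteq> 0" using q Suc(2) by auto
  have "degree p = Suc (degree q)" unfolding q using q0 by (subst degree_mult_eq) auto
  then have n: "degree q = n" using Suc(2) by simp
  have lc: "lead_coeff p = lead_coeff q" unfolding q lead_coeff_mult by simp
  let ?K = "(1 + M) ^ n * norm (lead_coeff q)"
  have "poly q t = 0 \<Longrightarrow> norm t \<le> M" for t using Suc(3)[of t] q by simp
  then have IH: "norm (coeff q j) \<le> ?K" for j using Suc(1)[of q j] n Suc(4) by simp
  have K: "?K \<ge> 0" using Suc(4) by simp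
  have "norm (coeff p i) = norm (coeff (pCons 0 q) i - \<alpha> * coeff q i)"
    unfolding q by simp
  also have "\<dots> \<le> norm (coeff (pCons 0 q) i) + norm \<alpha> * norm (coeff q i)"
    by (metis norm_mult norm_triangle_ineq4)
  also have "\<dots> \<le> ?K + M * ?K"
    using IH K Suc(3)[OF \<alpha>] Suc(4) by (intro add_mono mult_mono) (auto simp: coeff_pCons split: nat.split)
  also have "\<dots> = (1 + M) ^ degree p * norm (lead_coeff p)"
    by (subst lc, subst Suc(2)[symmetric]) (simp add: algebra_simps)
  finally show ?case .
qed

text \<open>A bound of Cauchy type: for \<open>norm t > 1\<close> each lower term is at most
  \<open>K * norm t ^ (degree p - 1)\<close>, and together they must balance the top term.\<close>

lemma root_bound_of_coeffs:
  fixes p :: "complex poly" and K :: real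
  assumes "lead_coeff p = 1" "\<And>i. i < degree p \<Longrightarrow> norm (coeff p i) \<le> K" "poly p t = 0" "K \<ge> 0"
  shows "norm t \<le> 1 + degree p * K"
proof (cases "norm t \<le> 1")
  case True
  then show ?thesis using assms(4) by (simp add: add_increasing2)
next
  case False
  let ?n = "degree p"
  have n: "?n \<noteq> 0"
  proof
    assume "?n = 0"
    then show False using assms(1,3) by (metis degree_eq_zeroE lead_coeff_pCons(2) one_pCons poly_1 zero_neq_one)
  qed
  have "poly p t = (\<Sum>i<?n. coeff p i * t ^ i) + t ^ ?n"
    unfolding poly_altdef using assms(1) by (simp add: lessThan_Suc_atMost[symmetric])
  then have "t ^ ?n = - (\<Sum>i<?n. coeff p i * t ^ i)" using assms(3) by (simp add: eq_neg_iff_add_eq_0 add.commute)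
  then have "norm t ^ ?n = norm (\<Sum>i<?n. coeff p i * t ^ i)" by (metis norm_minus_cancel norm_power)
  also have "\<dots> \<le> (\<Sum>i<?n. K * norm t ^ (?n - 1))"
  proof (rule sum_norm_le)
    fix i assume "i \<in> {..<?n}"
    then show "norm (coeff p i * t ^ i) \<le> K * norm t ^ (?n - 1)"
      unfolding norm_mult norm_power using assms(2,4) False
      by (intro mult_mono power_increasing) auto
  qed
  also have "\<dots> = ?n * K * norm t ^ (?n - 1)" by simp
  finally have "norm t * norm t ^ (?n - 1) \<le> ?n * K * norm t ^ (?n - 1)"
    using n by (simp flip: power_Suc)
  moreover have "norm t ^ (?n - 1) > 0" using False by (intro zero_less_power) linarith
  ultimately have "norm t \<le> ?n * K" by (simp only: mult_le_cancel_right_pos)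
  then show ?thesis by simp
qed

text \<open>After a shear the divisor is monic in one coordinate, and the remainder of the division
  vanishes by the case of one variable.\<close>

lemma polyfun_dvd_of_locally_bounded_quotient:
  assumes "finite S" and a: "polyfun S a" "a x \<noteq> 0" and b: "polyfun S b"
    and bound: "\<And>R. \<exists>C. \<forall>z. (\<forall>i\<in>S. norm (z i) \<le> R) \<longrightarrow> norm (b z) \<le> C * norm (a z)"
  shows "\<exists>q. polyfun S q \<and> (\<forall>z. b z = q z * a z)"
proof (cases "S = {}")
  case True
  have c: "f z = f x" if "polyfun S f" for f z
    by (rule polyfun_cong[OF that]) (auto simp: True)
  have "b z = (b x / a x) * a z" for z using c[OF a(1), of z] c[OF b, of z] a(2) by simp
  then show ?thesis using polyfun.const[of S "b x / a x"] by blast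
next
  case False
  obtain u v A d c where u: "u \<in> S" "v u = 0" "\<forall>i. i \<notin> S \<longrightarrow> v i = 0"
    and *: "polyc (S - {u}) A" "\<forall>z. degree (A z) = d" "\<forall>z. lead_coeff (A z) = 1" and "c \<noteq> 0"
    and aA: "\<forall>z. a (shear u v z) = c * poly (A z) (z u)"
    by (rule monic_shear[OF a False])
  from * have A: "polyc (S - {u}) A" "degree (A z) = d" "lead_coeff (A z) = 1" for z by auto
  have S: "insert u (S - {u}) = S" using u by blast
  obtain B where B: "polyc (S - {u}) B" "\<And>z t. b (shear u v (z(u := t))) = poly (B z) t"
      "\<And>z. b (shear u v z) = poly (B z) (z u)"
    using polyfun_in_coord[of u "S - {u}" "\<lambda>z. b (shear u v z)"] polyfun_shear[OF b u(1)]
    unfolding S by blast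
  have aA': "a (shear u v (z(u := t))) = c * poly (A z) t" for z t
  proof -
    have "A (z(u := t)) = A z" by (rule polyc_cong[OF A(1)]) auto
    then show ?thesis using aA by simp
  qed
  have "A z dvd B z" for z
  proof (rule poly_dvd_of_locally_bounded_quotient)
    show "A z \<noteq> 0" using A(3)[of z] by auto
    fix R
    \<comment> \<open>For \<open>norm t \<le> R\<close> the sheared line stays in the polydisc whose
      radius is the sum of all \<open>r i\<close>, so the bound in several variables restricts to
      one in \<open>t\<close>.\<close>
    define r where "r i = norm (z i) + \<bar>R\<bar> + \<bar>R\<bar> * norm (v i)" for i
    have "norm (shear u v (z(u := t)) i) \<le> (\<Sum>i\<in>S. r i)" if "norm t \<le> R" "i \<in> S" for t i
    proof -
      have "norm (shear u v (z(u := t)) i) \<le> norm ((z(u := t)) i) + norm t * norm (v i)"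
        unfolding shear_def by (simp flip: norm_mult) (intro conjI impI norm_triangle_ineq)
      also have "\<dots> \<le> r i"
      proof -
        have "norm t \<le> \<bar>R\<bar>" using that(1) by linarith
        then show ?thesis unfolding r_def
          by (intro add_mono mult_right_mono) (auto intro: add_increasing)
      qed
      also have "\<dots> \<le> (\<Sum>i\<in>S. r i)"
        using that \<open>finite S\<close> by (intro member_le_sum) (auto simp: r_def)
      finally show ?thesis .
    qed
    moreover obtain C where "\<And>z. (\<forall>i\<in>S. norm (z i) \<le> (\<Sum>i\<in>S. r i)) \<Longrightarrow> norm (b z) \<le> C * norm (a z)"
      using bound by blast
    ultimately have "norm (poly (B z) t) \<le> C * norm (c * poly (A z) t)" if "norm t \<le> R" for t
      using that unfolding B(2)[symmetric] aA'[symmetric] by blast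
    then show "\<exists>C. \<forall>t. norm t \<le> R \<longrightarrow> norm (poly (B z) t) \<le> C * norm (poly (A z) t)"
      by (intro exI[of _ "C * norm c"]) (simp add: norm_mult mult.assoc)
  qed
  then have BA: "B z = (B z div A z) * A z" for z by simp
  define q where "q z = (1 / c) * poly (B z div A z) (z u)" for z
  have "polyc S (\<lambda>z. B z div A z)"
    by (rule polyc_mono[OF polyc_divmod_monic(1)[OF B(1) A]]) auto
  then have "polyfun S q"
    unfolding q_def using u(1) by (intro polyfun.mult polyfun.const polyfun_poly polyfun.coord)
  then have "polyfun S (\<lambda>z. q (shear u (\<lambda>i. - v i) z))" using u(1) by (rule polyfun_shear)
  moreover have "b z = q (shear u (\<lambda>i. - v i) z) * a z" for z
  proof -
    define z' where "z' = shear u (\<lambda>i. - v i) z"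
    have z: "z = shear u v z'" unfolding z'_def using shear_inverse(2)[of v u z, OF u(2)] by simp
    have "b z = poly ((B z' div A z') * A z') (z' u)" unfolding z B(3) BA[symmetric] ..
    then show ?thesis unfolding z'_def[symmetric] q_def using aA \<open>c \<noteq> 0\<close> z by simp
  qed
  ultimately show ?thesis by blast
qed

section \<open>Proper projections of algebraic sets\<close>

text \<open>For a closed cylinder in finitely many coordinates \<open>E \<union> S\<close> this is
  properness of the projection that forgets \<open>E\<close>, with bounded sets in place of compact
  ones.\<close>

definition proper_on :: "'a set \<Rightarrow> 'a set \<Rightarrow> ('a \<Rightarrow> complex) set \<Rightarrow> bool" where
  "proper_on S E X \<longleftrightarrow>
     (\<forall>R. \<exists>M. \<forall>z\<in>X. (\<forall>i\<in>S. norm (z i) \<le> R) \<longrightarrow> (\<forall>i\<in>E. norm (z i) \<le> M))"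

lemma proper_on_subset: "proper_on S E X \<Longrightarrow> Y \<subseteq> X \<Longrightarrow> proper_on S E Y"
  unfolding proper_on_def by (meson subset_iff)

lemma proper_on_mono:
  assumes "proper_on S E X" "S \<subseteq> S'" "E' \<subseteq> E" shows "proper_on S' E' X"
  unfolding proper_on_def
proof
  fix R
  obtain M where "\<forall>z\<in>X. (\<forall>i\<in>S. norm (z i) \<le> R) \<longrightarrow> (\<forall>i\<in>E. norm (z i) \<le> M)"
    using assms(1) unfolding proper_on_def by blast
  then have "norm (z i) \<le> M" if "z \<in> X" "\<forall>i\<in>S'. norm (z i) \<le> R" "i \<in> E'" for z i
    using that assms(2,3) by (simp add: subset_iff)
  then show "\<exists>M. \<forall>z\<in>X. (\<forall>i\<in>S'. norm (z i) \<le> R) \<longrightarrow> (\<forall>i\<in>E'. norm (z i) \<le> M)"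
    by blast
qed

text \<open>Take \<open>P\<close> vanishing on \<open>X\<close> of minimal degree in the
  coordinate \<open>s\<close>. By pseudo-division every zero of \<open>P\<close> at which the leading coefficient \<open>a\<close> does not
  vanish lies in \<open>X\<close>. Hence the roots of \<open>P\<close> are locally bounded, so that \<open>a\<close> divides all
  coefficients.\<close>

lemma integral_of_proper_prime:
  assumes "finite S" and s: "s \<notin> S" and X: "alg_on (insert s S) X" "X \<noteq> {}"
    and proper: "proper_on S {s} X"
    and prime: "\<And>f g. polyfun (insert s S) f \<Longrightarrow> polyfun (insert s S) g \<Longrightarrow>
      \<forall>z\<in>X. f z * g z = 0 \<Longrightarrow> (\<forall>z\<in>X. f z = 0) \<or> (\<forall>z\<in>X. g z = 0)"
    and dominant: "\<And>b z. polyfun S b \<Longrightarrow> \<forall>z\<in>X. b z = 0 \<Longrightarrow> b z = 0"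
  shows "\<exists>F d. polyc S F \<and> (\<forall>z. degree (F z) = d \<and> lead_coeff (F z) = 1) \<and>
    (\<forall>z\<in>X. poly (F z) (z s) = 0)"
proof -
  define V where "V P \<longleftrightarrow> polyc S P \<and> (\<forall>z\<in>X. poly (P z) (z s) = 0)" for P
  define Q where "Q d \<longleftrightarrow> (\<exists>P. V P \<and> (\<exists>z. P z \<noteq> 0) \<and> (\<forall>z. degree (P z) \<le> d))" for d
  obtain M where M: "\<And>z. z \<in> X \<Longrightarrow> \<forall>i\<in>S. norm (z i) \<le> 0 \<Longrightarrow> norm (z s) \<le> M"
    using proper unfolding proper_on_def by blast
  \<comment> \<open>A point over the origin of the coordinates \<open>S\<close> whose coordinate
    \<open>s\<close> exceeds the bound given by properness. It lies outside \<open>X\<close>, so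
    some polynomial that vanishes on \<open>X\<close> is nonzero.\<close>
  define x where "x = (\<lambda>_. 0)(s := complex_of_real (\<bar>M\<bar> + 1))"
  have "norm (x s) > M" unfolding x_def by (simp only: fun_upd_same norm_of_real)
  moreover have "\<forall>i\<in>S. norm (x i) \<le> 0" using s by (auto simp: x_def)
  ultimately have "x \<notin> X" using M[of x] by linarith
  then obtain f where f: "f \<in> vanishing (insert s S) X" "f x \<noteq> 0"
    using alg_on_vanishing[OF X(1)] by blast
  have "\<exists>d. Q d"
  proof -
    have "polyfun (insert s S) f" using f(1) unfolding vanishing_def by blast
    from polyfun_in_coord[OF this s] obtain P where P: "polyc S P" "\<And>z. f z = poly (P z) (z s)"
      by blast
    then have "V P" "P x \<noteq> 0" using f unfolding V_def vanishing_def by auto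
    then show ?thesis using polyc_degree[OF P(1)] unfolding Q_def by blast
  qed
  then obtain d where d: "Q d" "\<And>e. e < d \<Longrightarrow> \<not> Q e" using exists_least_iff[of Q] by blast
  obtain P z0 where P: "polyc S P" "\<And>z. z \<in> X \<Longrightarrow> poly (P z) (z s) = 0" "P z0 \<noteq> 0"
    "\<And>z. degree (P z) \<le> d"
    using d(1) unfolding Q_def V_def by blast
  have min: "R z = 0" if "V R" "\<forall>z. \<forall>n\<ge>d. coeff (R z) n = 0" for R z
  proof (cases d)
    case 0
    then show ?thesis using that(2) by (intro poly_eqI) simp
  next
    case (Suc e)
    then have "degree (R z) \<le> e" for z using that(2) by (intro degree_le) auto
    then show ?thesis using d(2)[of e] Suc that(1) unfolding Q_def by blast
  qed
  define a where "a z = coeff (P z) d" for z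
  have a: "polyfun S a" unfolding a_def by (rule polyc_coeff[OF P(1)])
  have "\<exists>z. a z \<noteq> 0"
  proof (rule ccontr)
    assume "\<not> ?thesis"
    then have "coeff (P z) n = 0" if "n \<ge> d" for z n
      using that P(4)[of z] unfolding a_def
      by (cases "n = d") (auto intro: coeff_eq_0 le_less_trans)
    then show False using min[of P z0] P unfolding V_def by blast
  qed
  then obtain z1 where z1: "a z1 \<noteq> 0" by blast
  have inX: "z(s := t) \<in> X" if az: "a z \<noteq> 0" and t: "poly (P z) t = 0" for z t
  proof -
    have "g (z(s := t)) = 0" if g: "g \<in> vanishing (insert s S) X" for g
    proof -
      have "polyfun (insert s S) g" using g unfolding vanishing_def by blast
      from polyfun_in_coord[OF this s] obtain G where G: "polyc S G"
        "\<And>z t. g (z(s := t)) = poly (G z) t" "\<And>z. g z = poly (G z) (z s)" by blast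
      obtain k Q R where QR: "polyc S Q" "polyc S R" "\<forall>z. \<forall>n\<ge>d. coeff (R z) n = 0"
        "\<And>z. smult (a z ^ k) (G z) = Q z * P z + R z"
        using polyc_pseudo_div[OF G(1) P(1,4)] unfolding a_def by blast
      have "poly (R z) (z s) = 0" if "z \<in> X" for z
        using arg_cong[OF QR(4)[of z], of "\<lambda>p. poly p (z s)"] P(2)[OF that] G(3)[of z] that g
        by (simp add: vanishing_def)
      then have "R z = 0" using min[of R] QR(2,3) unfolding V_def by blast
      then have "a z ^ k * poly (G z) t = 0"
        using arg_cong[OF QR(4)[of z], of "\<lambda>p. poly p t"] t by simp
      then show ?thesis using az G(2) by simp
    qed
    then show ?thesis using alg_on_vanishing[OF X(1)] by blast
  qed
  have bound: "\<exists>C. \<forall>z. (\<forall>i\<in>S. norm (z i) \<le> R) \<longrightarrow> norm (coeff (P z) n) \<le> C * norm (a z)" for R n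
  proof -
    \<comment> \<open>The inequality is first proved where \<open>a\<close> does not vanish; passing
      to the zeros of \<open>a\<close> by density requires the larger radius
      \<open>R + 1\<close>.\<close>
    obtain M where M: "\<And>z. z \<in> X \<Longrightarrow> \<forall>i\<in>S. norm (z i) \<le> R + 1 \<Longrightarrow> norm (z s) \<le> M"
      using proper unfolding proper_on_def by blast
    define C where "C = (1 + \<bar>M\<bar>) ^ d"
    have "norm (coeff (P z) n) \<le> norm (of_real C * a z)" if R: "\<forall>i\<in>S. norm (z i) \<le> R" for z
    proof (rule polyfun_dense_le[OF polyc_coeff[OF P(1)] _ a z1 \<open>finite S\<close>])
      show "polyfun S (\<lambda>z. of_real C * a z)" using a by (intro polyfun_intros)
      show "norm (z i) < R + 1" if "i \<in> S" for i using R that by fastforce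
    next
      fix z assume z: "\<forall>i\<in>S. norm (z i) \<le> R + 1" and az: "a z \<noteq> 0"
      have deg: "degree (P z) = d"
        using P(4)[of z] az le_degree[of "P z" d] unfolding a_def by simp
      have "norm t \<le> \<bar>M\<bar>" if "poly (P z) t = 0" for t
        using M[OF inX[OF az that]] z s by fastforce
      from coeff_bound_of_roots[of "P z" "\<bar>M\<bar>" n, OF this]
      have "norm (coeff (P z) n) \<le> C * norm (a z)" unfolding deg a_def C_def by simp
      moreover have "C \<ge> 0" unfolding C_def by simp
      ultimately show "norm (coeff (P z) n) \<le> norm (of_real C * a z)" by (simp add: norm_mult)
    qed
    then show ?thesis by (intro exI[of _ "norm (of_real C :: complex)"]) (simp add: norm_mult)
  qed
  have "\<exists>q. polyfun S q \<and> (\<forall>z. coeff (P z) n = q z * a z)" for n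
    by (rule polyfun_dvd_of_locally_bounded_quotient[OF \<open>finite S\<close> a z1 polyc_coeff[OF P(1)] bound])
  then obtain q where q: "\<And>n. polyfun S (q n)" "\<And>n z. coeff (P z) n = q n z * a z" by metis
  define F where "F z = (\<Sum>n<d. monom (q n z) n) + monom 1 d" for z
  have coF: "coeff (F z) n = (if n < d then q n z else if n = d then 1 else 0)" for z n
    unfolding F_def by (auto simp: coeff_sum)
  have F: "polyc S F"
    unfolding F_def using q(1) by (intro polyc_add polyc_sum polyc_monom polyfun.const)
  have degF: "degree (F z) = d" for z
  proof (rule antisym)
    show "degree (F z) \<le> d" using coF by (intro degree_le) auto
    show "d \<le> degree (F z)" using coF[of z d] by (intro le_degree) auto
  qed
  have PF: "P z = smult (a z) (F z)" for z
  proof (rule poly_eqI)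
    fix n
    have "coeff (P z) n = 0" if "n > d" using that P(4)[of z] by (simp add: coeff_eq_0)
    then show "coeff (P z) n = coeff (smult (a z) (F z)) n"
      using q(2)[of z n] unfolding coeff_smult coF by (cases n d rule: linorder_cases) (auto simp: a_def)
  qed
  \<comment> \<open>\<open>P = a F\<close> vanishes on \<open>X\<close>, and \<open>a\<close> cannot
    vanish on all of \<open>X\<close> because it is a nonzero polynomial in the coordinates
    \<open>S\<close>.\<close>
  have "(\<forall>z\<in>X. a z = 0) \<or> (\<forall>z\<in>X. poly (F z) (z s) = 0)"
  proof (rule prime)
    show "polyfun (insert s S) a" using a by (rule polyfun_mono) auto
    show "polyfun (insert s S) (\<lambda>z. poly (F z) (z s))"
      by (intro polyfun_poly polyc_mono[OF F] polyfun.coord) auto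
    show "\<forall>z\<in>X. a z * poly (F z) (z s) = 0" using P(2) unfolding PF by simp
  qed
  then have "\<forall>z\<in>X. poly (F z) (z s) = 0" using dominant[OF a] z1 by blast
  then show ?thesis using F degF coF by (intro exI[of _ F] exI[of _ d]) auto
qed

text \<open>If some nonzero polynomial in the coordinates \<open>S\<close> vanishes on \<open>X\<close>, then after a shear it is
  monic in some coordinate of \<open>S\<close>, which can be eliminated without affecting the coordinate \<open>s\<close>.\<close>

lemma integral_of_proper_step:
  assumes "finite S" and s: "s \<notin> S" and X: "alg_on (insert s S) X" "X \<noteq> {}"
    and proper: "proper_on S {s} X"
    and b: "polyfun S b" "\<forall>z\<in>X. b z = 0" "b x \<noteq> 0"
    and IH: "\<And>T X. T \<subset> S \<Longrightarrow> alg_on (insert s T) X \<Longrightarrow> proper_on T {s} X \<Longrightarrow>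
      \<exists>F d. polyc T F \<and> (\<forall>z. degree (F z) = d \<and> lead_coeff (F z) = 1) \<and>
        (\<forall>z\<in>X. poly (F z) (z s) = 0)"
  shows "\<exists>F d. polyc S F \<and> (\<forall>z. degree (F z) = d \<and> lead_coeff (F z) = 1) \<and>
    (\<forall>z\<in>X. poly (F z) (z s) = 0)"
proof -
  have "S \<noteq> {}"
  proof
    assume "S = {}"
    obtain z where "z \<in> X" using X(2) by blast
    moreover have "b z = b x" by (rule polyfun_cong[OF b(1)]) (auto simp: \<open>S = {}\<close>)
    ultimately show False using b by simp
  qed
  obtain u v P d c where u: "u \<in> S" "v u = 0" "\<forall>i. i \<notin> S \<longrightarrow> v i = 0"
    and *: "polyc (S - {u}) P" "\<forall>z. degree (P z) = d" "\<forall>z. lead_coeff (P z) = 1" and "c \<noteq> 0"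
    and bP: "\<forall>z. b (shear u v z) = c * poly (P z) (z u)"
    by (rule monic_shear[OF b(1,3) \<open>S \<noteq> {}\<close>])
  from * have P: "polyc (S - {u}) P" "degree (P z) = d" "lead_coeff (P z) = 1" for z by auto
  define T where "T = S - {u}"
  have S: "insert u T = S" and T: "T \<subset> S" "finite T" "u \<notin> insert s T"
    using u(1) s \<open>finite S\<close> by (auto simp: T_def)
  define X' where "X' = {z. shear u v z \<in> X}"
  define Y where "Y = {z. \<exists>t. z(u := t) \<in> X'}"
  have PX': "poly (P z) (z u) = 0" if "z \<in> X'" for z
    using that b(2) bP \<open>c \<noteq> 0\<close> unfolding X'_def by force
  have "alg_on (insert u (insert s T)) X'"
  proof -
    have "insert u (insert s T) = insert s S" using S by auto
    then show ?thesis unfolding X'_def using u(1)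
      by (intro alg_on_compose[OF X(1)]) (auto simp: shear_def intro!: polyfun_intros)
  qed
  then have Y: "alg_on (insert s T) Y" unfolding Y_def
    using P PX' T(3) polyc_mono[OF P(1), of "insert s T"]
    by (intro alg_on_eliminate[where F = P and d = d]) (auto simp: T_def)
  \<comment> \<open>If the coordinates in \<open>T\<close> are bounded, so is \<open>t\<close>, as a
    root of a monic polynomial with bounded coefficients. Then all coordinates in \<open>S\<close>
    of the sheared point are bounded, and properness of \<open>X\<close> bounds the coordinate
    \<open>s\<close>.\<close>
  have "proper_on T {s} Y" unfolding proper_on_def
  proof
    fix R
    have "\<forall>n. \<exists>K. \<forall>z. (\<forall>i\<in>T. norm (z i) \<le> R) \<longrightarrow> norm (coeff (P z) n) \<le> K"
      using polyfun_bounded[OF polyc_coeff[OF P(1)]] unfolding T_def by blast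
    then obtain K where K: "\<And>n z. \<forall>i\<in>T. norm (z i) \<le> R \<Longrightarrow> norm (coeff (P z) n) \<le> K n"
      by metis
    define L where "L = (\<Sum>n<d. \<bar>K n\<bar>)"
    define B where "B = 1 + d * L"
    have "L \<ge> 0" unfolding L_def by (intro sum_nonneg) auto
    have tB: "norm t \<le> B" if z: "z(u := t) \<in> X'" "\<forall>i\<in>T. norm (z i) \<le> R" for z t
    proof -
      have Pz: "P (z(u := t)) = P z" by (rule polyc_cong[OF P(1)]) auto
      have "norm (coeff (P z) n) \<le> L" if "n < d" for n
      proof -
        have "\<bar>K n\<bar> \<le> L" unfolding L_def using that by (intro member_le_sum) auto
        then show ?thesis using K[OF z(2), of n] by linarith
      qed
      then show ?thesis using root_bound_of_coeffs[of "P z" L t] PX'[OF z(1)] P \<open>L \<ge> 0\<close>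
        unfolding B_def by (simp add: Pz)
    qed
    define N where "N = \<bar>R\<bar> + \<bar>B\<bar> + (\<Sum>i\<in>S. \<bar>B\<bar> * norm (v i))"
    obtain M where M: "\<And>z. z \<in> X \<Longrightarrow> \<forall>i\<in>S. norm (z i) \<le> N \<Longrightarrow> norm (z s) \<le> M"
      using proper unfolding proper_on_def by blast
    have "norm (z s) \<le> M" if z: "z \<in> Y" "\<forall>i\<in>T. norm (z i) \<le> R" for z
    proof -
      obtain t where t: "z(u := t) \<in> X'" using z(1) unfolding Y_def by blast
      let ?w = "shear u v (z(u := t))"
      have "norm (?w i) \<le> N" if i: "i \<in> S" for i
      proof -
        have "norm (?w i) \<le> norm ((z(u := t)) i) + norm (t * v i)"
          unfolding shear_def using norm_triangle_ineq by auto
        moreover have "norm ((z(u := t)) i) \<le> \<bar>R\<bar> + \<bar>B\<bar>"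
          using i z(2) tB[OF t z(2)] by (cases "i = u") (force simp: T_def)+
        moreover have "norm (t * v i) \<le> (\<Sum>i\<in>S. \<bar>B\<bar> * norm (v i))"
        proof -
          have "norm (t * v i) \<le> \<bar>B\<bar> * norm (v i)"
            unfolding norm_mult using tB[OF t z(2)] by (intro mult_right_mono) auto
          also have "\<dots> \<le> (\<Sum>i\<in>S. \<bar>B\<bar> * norm (v i))"
            using i \<open>finite S\<close> by (intro member_le_sum) auto
          finally show ?thesis .
        qed
        ultimately show ?thesis unfolding N_def by linarith
      qed
      moreover have "?w \<in> X" using t unfolding X'_def by (rule CollectD)
      ultimately have "norm (?w s) \<le> M" using M by blast
      moreover have "?w s = z s" using s u by (auto simp: shear_def)
      ultimately show ?thesis by simp
    qed
    then show "\<exists>M. \<forall>z\<in>Y. (\<forall>i\<in>T. norm (z i) \<le> R) \<longrightarrow> (\<forall>i\<in>{s}. norm (z i) \<le> M)" by auto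
  qed
  from IH[OF T(1) Y this] obtain F e where F: "polyc T F"
    "\<forall>z. degree (F z) = e \<and> lead_coeff (F z) = 1" "\<forall>z\<in>Y. poly (F z) (z s) = 0" by blast
  let ?h = "\<lambda>z. shear u (\<lambda>i. - v i) z"
  have "polyc S (\<lambda>z. F (?h z))"
    by (rule polyc_compose[OF F(1)]) (use u(1) T in \<open>auto simp: shear_def intro!: polyfun_intros\<close>)
  moreover have "poly (F (?h z)) (z s) = 0" if "z \<in> X" for z
  proof -
    have "?h z \<in> X'" unfolding X'_def using that u by (simp add: shear_inverse)
    then have "(?h z)(u := ?h z u) \<in> X'" by simp
    then have "?h z \<in> Y" unfolding Y_def by blast
    then have "poly (F (?h z)) (?h z s) = 0" using F(3) by blast
    moreover have "?h z s = z s" using s u by (auto simp: shear_def)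
    ultimately show ?thesis by simp
  qed
  ultimately show ?thesis using F(2) by (intro exI[of _ "\<lambda>z. F (?h z)"] exI[of _ e]) blast
qed

text \<open>The outer induction on \<open>S\<close> serves the elimination of a further coordinate,
  the inner Noetherian induction on \<open>X\<close> serves the splitting. The empty set has the
  equation 1 of degree 0.\<close>

theorem integral_of_proper:
  assumes "finite S" "s \<notin> S" "alg_on (insert s S) X" "proper_on S {s} X"
  shows "\<exists>F d. polyc S F \<and> (\<forall>z. degree (F z) = d \<and> lead_coeff (F z) = 1) \<and>
    (\<forall>z\<in>X. poly (F z) (z s) = 0)"
  using assms
proof (induction S arbitrary: X rule: finite_psubset_induct)
  case (psubset S)
  let ?goal = "\<lambda>X. \<exists>F d. polyc S F \<and> (\<forall>z. degree (F z) = d \<and> lead_coeff (F z) = 1) \<and>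
    (\<forall>z\<in>X. poly (F z) (z s) = 0)"
  let ?T = "insert s S"
  have wf: "wf {(X, Y). alg_on ?T X \<and> alg_on ?T Y \<and> X \<subset> Y}"
    using psubset(1) by (intro wf_alg_on) simp
  have "alg_on ?T X \<longrightarrow> proper_on S {s} X \<longrightarrow> ?goal X"
  proof (induction X rule: wf_induct_rule[OF wf])
    case (1 X)
    show ?case
    proof (intro impI)
      assume X: "alg_on ?T X" and proper: "proper_on S {s} X"
      have IH: "?goal Y" if "alg_on ?T Y" "Y \<subset> X" for Y
        using 1[of Y] that X proper_on_subset[OF proper, of Y] by auto
      show "?goal X"
      proof (cases "X = {}")
        case True
        then show ?thesis
          by (intro exI[of _ "\<lambda>z. 1"] exI[of _ 0]) (auto intro: polyc_const)
      next
        case ne: False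
        show ?thesis
        proof (cases "\<exists>f g. polyfun ?T f \<and> polyfun ?T g \<and> (\<forall>z\<in>X. f z * g z = 0) \<and>
            (\<exists>z\<in>X. f z \<noteq> 0) \<and> (\<exists>z\<in>X. g z \<noteq> 0)")
          case True
          then obtain f g where fg: "polyfun ?T f" "polyfun ?T g" "\<forall>z\<in>X. f z * g z = 0"
            "\<exists>z\<in>X. f z \<noteq> 0" "\<exists>z\<in>X. g z \<noteq> 0" by blast
          have "?goal (X \<inter> {z. f z = 0})" "?goal (X \<inter> {z. g z = 0})"
            using fg by (intro IH alg_on_Int[OF X alg_on_zeros]; blast)+
          then obtain F d G e where F: "polyc S F"
              "\<And>z. degree (F z) = d \<and> lead_coeff (F z) = 1"
              "\<And>z. z \<in> X \<Longrightarrow> f z = 0 \<Longrightarrow> poly (F z) (z s) = 0"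
            and G: "polyc S G" "\<And>z. degree (G z) = e \<and> lead_coeff (G z) = 1"
              "\<And>z. z \<in> X \<Longrightarrow> g z = 0 \<Longrightarrow> poly (G z) (z s) = 0" by blast
          have "F z \<noteq> 0" "G z \<noteq> 0" for z using F(2)[of z] G(2)[of z] by auto
          then have "degree (F z * G z) = d + e" for z using F(2) G(2) by (simp add: degree_mult_eq)
          moreover have "lead_coeff (F z * G z) = 1" for z
            unfolding lead_coeff_mult conjunct2[OF F(2)] conjunct2[OF G(2)] by simp
          moreover have "poly (F z * G z) (z s) = 0" if "z \<in> X" for z
            using F(3)[OF that] G(3)[OF that] fg(3) that by auto
          ultimately show ?thesis
            using polyc_mult[OF F(1) G(1)]
            by (intro exI[of _ "\<lambda>z. F z * G z"] exI[of _ "d + e"]) blast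
        next
          case False
          then have prime: "(\<forall>z\<in>X. f z = 0) \<or> (\<forall>z\<in>X. g z = 0)"
            if "polyfun ?T f" "polyfun ?T g" "\<forall>z\<in>X. f z * g z = 0" for f g
            using that by blast
          show ?thesis
          proof (cases "\<exists>b x. polyfun S b \<and> (\<forall>z\<in>X. b z = 0) \<and> b x \<noteq> 0")
            case True
            then obtain b x where "polyfun S b" "\<forall>z\<in>X. b z = 0" "b x \<noteq> 0" by blast
            then show ?thesis
              using psubset(1,3) X ne proper psubset(2)
              by (intro integral_of_proper_step[of S s X b x]) auto
          next
            case False
            then show ?thesis
              using psubset(1,3) X ne proper prime
              by (intro integral_of_proper_prime) auto
          qed
        qed
      qed
    qed
  qed
  then show ?case using psubset by blast
qed

text \<open>Coordinates are forgotten one at a time: properness over \<open>S\<close> implies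
  properness of \<open>e\<close> over \<open>E \<union> S\<close>, hence a monic equation for
  \<open>e\<close>, and the projected set is again proper over \<open>S\<close>.\<close>

theorem alg_on_proper_image:
  assumes "finite E" "finite S" "E \<inter> S = {}" "alg_on (E \<union> S) X" "proper_on S E X"
  shows "alg_on S {z. \<exists>w\<in>X. \<forall>i. i \<notin> E \<longrightarrow> w i = z i}"
  using assms
proof (induction E arbitrary: X rule: finite_induct)
  case empty
  have "{z. \<exists>w\<in>X. \<forall>i. i \<notin> {} \<longrightarrow> w i = z i} = X" by (auto simp flip: fun_eq_iff)
  then show ?case using empty by simp
next
  case (insert e E)
  let ?Y = "{z. \<exists>c. z(e := c) \<in> X}"
  have e: "e \<notin> E \<union> S" using insert by auto
  have X: "alg_on (insert e (E \<union> S)) X" using insert by simp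
  have "proper_on (E \<union> S) {e} X"
    by (rule proper_on_mono[OF insert(7)]) auto
  then obtain F d where F: "polyc (E \<union> S) F" "\<And>z. degree (F z) = d \<and> lead_coeff (F z) = 1"
      "\<And>z. z \<in> X \<Longrightarrow> poly (F z) (z e) = 0"
    using integral_of_proper[OF _ e X] insert(1,4) by (metis finite_UnI)
  have Y: "alg_on (E \<union> S) ?Y"
    by (rule alg_on_eliminate[OF X e F(1) conjunct1[OF F(2)] conjunct2[OF F(2)] F(3)])
  have "proper_on S E ?Y" unfolding proper_on_def
  proof
    fix R
    obtain M where M: "\<And>z i. z \<in> X \<Longrightarrow> \<forall>i\<in>S. norm (z i) \<le> R \<Longrightarrow> i \<in> insert e E \<Longrightarrow> norm (z i) \<le> M"
      using insert(7) unfolding proper_on_def by blast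
    have "norm (z i) \<le> M" if "z \<in> ?Y" "\<forall>i\<in>S. norm (z i) \<le> R" "i \<in> E" for z i
    proof -
      obtain c where c: "z(e := c) \<in> X" using \<open>z \<in> ?Y\<close> by blast
      have "\<forall>i\<in>S. norm ((z(e := c)) i) \<le> R" using e that(2) by auto
      from M[OF c this, of i] show ?thesis using that(3) e by (auto split: if_splits)
    qed
    then show "\<exists>M. \<forall>z\<in>?Y. (\<forall>i\<in>S. norm (z i) \<le> R) \<longrightarrow> (\<forall>i\<in>E. norm (z i) \<le> M)" by blast
  qed
  then have "alg_on S {z. \<exists>w\<in>?Y. \<forall>i. i \<notin> E \<longrightarrow> w i = z i}"
    using insert Y by (intro insert(3)) auto
  moreover have "{z. \<exists>w\<in>?Y. \<forall>i. i \<notin> E \<longrightarrow> w i = z i} = {z. \<exists>w\<in>X. \<forall>i. i \<notin> insert e E \<longrightarrow> w i = z i}"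
  proof (intro Collect_cong iffI)
    fix z assume "\<exists>w\<in>?Y. \<forall>i. i \<notin> E \<longrightarrow> w i = z i"
    then obtain w c where "w(e := c) \<in> X" "\<forall>i. i \<notin> E \<longrightarrow> w i = z i" by blast
    then show "\<exists>w\<in>X. \<forall>i. i \<notin> insert e E \<longrightarrow> w i = z i"
      by (intro bexI[of _ "w(e := c)"]) auto
  next
    fix z assume "\<exists>w\<in>X. \<forall>i. i \<notin> insert e E \<longrightarrow> w i = z i"
    then obtain w where w: "w \<in> X" "\<forall>i. i \<notin> insert e E \<longrightarrow> w i = z i" by blast
    have "(w(e := z e))(e := w e) \<in> X" using w(1) by simp
    then have "w(e := z e) \<in> ?Y" by blast
    then show "\<exists>w\<in>?Y. \<forall>i. i \<notin> E \<longrightarrow> w i = z i" by (rule bexI[rotated]) (use w(2) in auto)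
  qed
  ultimately show ?case by simp
qed

section \<open>Algebraic sets in coordinate space\<close>

lemma polyfun_of_complex_polynomial_function:
  "complex_polynomial_function f \<Longrightarrow> polyfun UNIV (\<lambda>z. f (vec_lambda z))"
  by (induction rule: complex_polynomial_function.induct) (auto intro: polyfun.intros)

lemma complex_polynomial_function_of_polyfun:
  "polyfun UNIV g \<Longrightarrow> complex_polynomial_function (\<lambda>z. g (vec_nth z))"
  by (induction rule: polyfun.induct) (auto intro: complex_polynomial_function.intros)

lemma algebraic_set_iff_alg_on: "algebraic_set A \<longleftrightarrow> alg_on UNIV {z. vec_lambda z \<in> A}"
proof
  assume "algebraic_set A"
  then obtain F where F: "\<forall>f\<in>F. complex_polynomial_function f" "A = {z. \<forall>f\<in>F. f z = 0}"
    unfolding algebraic_set_def by blast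
  have "alg_on UNIV {z. \<forall>g\<in>(\<lambda>f z. f (vec_lambda z)) ` F. g z = 0}"
    using F(1) by (intro alg_onI) (auto intro: polyfun_of_complex_polynomial_function)
  then show "alg_on UNIV {z. vec_lambda z \<in> A}" unfolding F(2) by simp
next
  assume "alg_on UNIV {z. vec_lambda z \<in> A}"
  then obtain F where F: "\<forall>f\<in>F. polyfun UNIV f" "{z. vec_lambda z \<in> A} = {z. \<forall>f\<in>F. f z = 0}"
    unfolding alg_on_def by blast
  have "v \<in> A \<longleftrightarrow> (\<forall>f\<in>F. f (vec_nth v) = 0)" for v
  proof -
    have "v \<in> A \<longleftrightarrow> vec_nth v \<in> {z. vec_lambda z \<in> A}" by simp
    then show ?thesis unfolding F(2) by simp
  qed
  then have "A = {v. \<forall>f\<in>(\<lambda>f v. f (vec_nth v)) ` F. f v = 0}" by auto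
  moreover have "\<forall>f\<in>(\<lambda>f v. f (vec_nth v)) ` F. complex_polynomial_function f"
    using F(1) by (auto intro: complex_polynomial_function_of_polyfun)
  ultimately show "algebraic_set A" unfolding algebraic_set_def by blast
qed

lemma algebraic_set_Int:
  assumes "algebraic_set A" "algebraic_set B" shows "algebraic_set (A \<inter> B)"
  using alg_on_Int assms unfolding algebraic_set_iff_alg_on by (simp add: Collect_conj_eq)

lemma algebraic_set_Un:
  assumes "algebraic_set A" "algebraic_set B" shows "algebraic_set (A \<union> B)"
proof -
  obtain F G where F: "\<forall>f\<in>F. complex_polynomial_function f" "A = {z. \<forall>f\<in>F. f z = 0}"
    and G: "\<forall>f\<in>G. complex_polynomial_function f" "B = {z. \<forall>f\<in>G. f z = 0}"
    using assms unfolding algebraic_set_def by blast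
  let ?H = "(\<lambda>(f, g) z. f z * g z) ` (F \<times> G)"
  have "\<forall>h\<in>?H. complex_polynomial_function h"
    using F(1) G(1) by (auto intro: complex_polynomial_function.mult)
  moreover have "A \<union> B = {z. \<forall>h\<in>?H. h z = 0}" unfolding F(2) G(2) by auto
  ultimately show ?thesis unfolding algebraic_set_def by blast
qed

lemma algebraic_set_empty: "algebraic_set {}"
  unfolding algebraic_set_def
  by (rule exI[of _ "{\<lambda>z. 1}"]) (auto intro: complex_polynomial_function.const)

lemma algebraic_set_zeros: "complex_polynomial_function f \<Longrightarrow> algebraic_set {z. f z = 0}"
  unfolding algebraic_set_def by (rule exI[of _ "{f}"]) auto

lemma algebraic_set_Union: "finite F \<Longrightarrow> \<forall>A\<in>F. algebraic_set A \<Longrightarrow> algebraic_set (\<Union>F)"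
  by (induction rule: finite_induct) (auto intro: algebraic_set_empty algebraic_set_Un)

lemma continuous_complex_polynomial_function:
  "complex_polynomial_function f \<Longrightarrow> continuous_on UNIV f"
  by (induction rule: complex_polynomial_function.induct) (auto intro!: continuous_intros)

lemma closed_algebraic_set:
  assumes "algebraic_set A" shows "closed A"
proof -
  obtain F where F: "\<forall>f\<in>F. complex_polynomial_function f" "A = {z. \<forall>f\<in>F. f z = 0}"
    using assms unfolding algebraic_set_def by blast
  have "A = (\<Inter>f\<in>F. {z. f z = 0})" unfolding F(2) by auto
  moreover have "closed {z. f z = 0}" if "f \<in> F" for f
    using continuous_complex_polynomial_function F(1) that
    by (intro closed_Collect_eq continuous_on_const) auto
  ultimately show ?thesis by auto
qed

lemma wf_algebraic_set:
  "wf {(A, B). algebraic_set A \<and> algebraic_set B \<and> A \<subset> (B :: (complex ^ 'n) set)}"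
proof -
  let ?c = "\<lambda>A :: (complex ^ 'n) set. {z. vec_lambda z \<in> A}"
  have "?c A \<subset> ?c B" if "A \<subset> B" for A B :: "(complex ^ 'n) set"
    using that by (auto simp: psubset_eq set_eq_iff) (metis vec_nth_inverse)
  then have "{(A, B). algebraic_set A \<and> algebraic_set B \<and> A \<subset> (B :: (complex ^ 'n) set)} \<subseteq>
    inv_image {(X, Y). alg_on UNIV X \<and> alg_on UNIV Y \<and> X \<subset> Y} ?c"
    unfolding algebraic_set_iff_alg_on inv_image_def by blast
  then show ?thesis by (rule wf_subset[rotated]) (intro wf_inv_image wf_alg_on finite)
qed

section \<open>Irreducible sets and finite decompositions\<close>

lemma irreducible_algebraic: "irreducible_algebraic_set A \<Longrightarrow> algebraic_set A"
  unfolding irreducible_algebraic_set_def by (elim conjE)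

lemma irreducible_nonempty: "irreducible_algebraic_set A \<Longrightarrow> A \<noteq> {}"
  unfolding irreducible_algebraic_set_def by (elim conjE)

lemma irreducible_subset_Un:
  assumes "irreducible_algebraic_set A" "algebraic_set B" "algebraic_set C" "A \<subseteq> B \<union> C"
  shows "A \<subseteq> B \<or> A \<subseteq> C"
proof -
  have "algebraic_set (A \<inter> B)" "algebraic_set (A \<inter> C)"
    by (rule algebraic_set_Int[OF irreducible_algebraic[OF assms(1)] assms(2)],
        rule algebraic_set_Int[OF irreducible_algebraic[OF assms(1)] assms(3)])
  moreover have "A = (A \<inter> B) \<union> (A \<inter> C)" using assms(4) by blast
  moreover have "\<forall>B C. algebraic_set B \<longrightarrow> algebraic_set C \<longrightarrow> A = B \<union> C \<longrightarrow> A = B \<or> A = C"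
    using assms(1) unfolding irreducible_algebraic_set_def by (elim conjE)
  ultimately have "A = A \<inter> B \<or> A = A \<inter> C" by (simp only: simp_thms)
  then show ?thesis by blast
qed

lemma irreducible_subset_Union:
  assumes "irreducible_algebraic_set A" "finite F" "\<forall>B\<in>F. algebraic_set B" "A \<subseteq> \<Union>F"
  shows "\<exists>B\<in>F. A \<subseteq> B"
  using assms(2-4)
proof (induction rule: finite_induct)
  case empty
  then show ?case using irreducible_nonempty[OF assms(1)] by simp
next
  case (insert B F)
  then have "A \<subseteq> B \<or> A \<subseteq> \<Union>F"
    by (intro irreducible_subset_Un[OF assms(1)] algebraic_set_Union) auto
  then show ?case using insert by auto
qed

lemma irreducible_mult_eq_0:
  assumes "irreducible_algebraic_set A" "complex_polynomial_function f"
    "complex_polynomial_function g" "\<forall>z\<in>A. f z * g z = 0"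
  shows "(\<forall>z\<in>A. f z = 0) \<or> (\<forall>z\<in>A. g z = 0)"
proof -
  have "A \<subseteq> {z. f z = 0} \<union> {z. g z = 0}" using assms(4) by auto
  from irreducible_subset_Un[OF assms(1) algebraic_set_zeros algebraic_set_zeros this] assms(2,3)
  show ?thesis by blast
qed

lemma irreducible_decomposition:
  assumes "algebraic_set A"
  shows "\<exists>F. finite F \<and> (\<forall>B\<in>F. irreducible_algebraic_set B) \<and> A = \<Union>F"
proof -
  have "algebraic_set A \<longrightarrow> ?thesis"
  proof (induction A rule: wf_induct_rule[OF wf_algebraic_set])
    case (1 A)
    show ?case
    proof
      assume A: "algebraic_set A"
      show "\<exists>F. finite F \<and> (\<forall>B\<in>F. irreducible_algebraic_set B) \<and> A = \<Union>F"
      proof (cases "A = {} \<or> irreducible_algebraic_set A")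
        case True
        then show ?thesis
        proof
          assume "A = {}"
          then show ?thesis by (intro exI[of _ "{}"]) auto
        next
          assume "irreducible_algebraic_set A"
          then show ?thesis by (intro exI[of _ "{A}"]) auto
        qed
      next
        case False
        then obtain B C where BC: "algebraic_set B" "algebraic_set C" "A = B \<union> C" "A \<noteq> B" "A \<noteq> C"
          using A unfolding irreducible_algebraic_set_def by blast
        then have "B \<subset> A" "C \<subset> A" by auto
        then obtain F G where
            "finite F" "\<forall>B\<in>F. irreducible_algebraic_set B" "B = \<Union>F"
            "finite G" "\<forall>B\<in>G. irreducible_algebraic_set B" "C = \<Union>G"
          using 1[of B] 1[of C] A BC by auto
        then show ?thesis using BC(3) by (intro exI[of _ "F \<union> G"]) auto
      qed
    qed
  qed
  then show ?thesis using assms by blast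
qed

text \<open>Every irreducible subset of \<open>X\<close> lies in a member of a finite decomposition,
  so the members maximal under inclusion are components.\<close>

lemma irreducible_subset_component:
  assumes "algebraic_set X" "irreducible_algebraic_set A" "A \<subseteq> X"
  shows "\<exists>C. irreducible_component_of C X \<and> A \<subseteq> C"
proof -
  obtain F where F: "finite F" "\<forall>B\<in>F. irreducible_algebraic_set B" "X = \<Union>F"
    using irreducible_decomposition[OF assms(1)] by blast
  have sub: "\<exists>C\<in>F. D \<subseteq> C" if "irreducible_algebraic_set D" "D \<subseteq> X" for D
    using that F by (intro irreducible_subset_Union) (auto intro: irreducible_algebraic)
  obtain B where "B \<in> F" "A \<subseteq> B" using sub assms(2,3) by blast
  obtain C where C: "C \<in> F" "B \<subseteq> C" "\<forall>D\<in>F. C \<subseteq> D \<longrightarrow> C = D"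
    using finite_has_maximal2[OF F(1) \<open>B \<in> F\<close>] by blast
  have "D = C" if "irreducible_algebraic_set D" "C \<subseteq> D" "D \<subseteq> X" for D
    using sub[OF that(1,3)] C(3) that(2) by blast
  then have "irreducible_component_of C X"
    unfolding irreducible_component_of_def using C(1) F by blast
  then show ?thesis using \<open>A \<subseteq> B\<close> C(2) by blast
qed


section \<open>Proper polynomial maps on algebraic sets\<close>

definition polynomial_map :: "(complex ^ 'm \<Rightarrow> complex ^ 'n) \<Rightarrow> bool" where
  "polynomial_map P \<longleftrightarrow> (\<forall>j. complex_polynomial_function (\<lambda>z. P z $ j))"

definition norm_proper_on :: "('a::real_normed_vector) set \<Rightarrow> ('a \<Rightarrow> 'b::real_normed_vector) \<Rightarrow> bool"
  where "norm_proper_on X P \<longleftrightarrow> (\<forall>R. \<exists>M. \<forall>z\<in>X. norm (P z) \<le> R \<longrightarrow> norm z \<le> M)"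

lemma norm_proper_on_subset: "norm_proper_on X P \<Longrightarrow> Y \<subseteq> X \<Longrightarrow> norm_proper_on Y P"
  unfolding norm_proper_on_def by (meson subset_iff)

lemma complex_polynomial_function_compose:
  assumes "complex_polynomial_function f" "polynomial_map P"
  shows "complex_polynomial_function (\<lambda>z. f (P z))"
  using assms(1)
  by (induction rule: complex_polynomial_function.induct)
     (use assms(2) in \<open>auto simp: polynomial_map_def intro: complex_polynomial_function.intros\<close>)

lemma algebraic_set_preimage:
  assumes "algebraic_set B" "polynomial_map P" shows "algebraic_set {z. P z \<in> B}"
proof -
  obtain F where F: "\<forall>f\<in>F. complex_polynomial_function f" "B = {z. \<forall>f\<in>F. f z = 0}"
    using assms(1) unfolding algebraic_set_def by blast
  have "\<forall>f\<in>(\<lambda>f z. f (P z)) ` F. complex_polynomial_function f"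
    using F(1) assms(2) by (auto intro: complex_polynomial_function_compose)
  moreover have "{z. P z \<in> B} = {z. \<forall>f\<in>(\<lambda>f z. f (P z)) ` F. f z = 0}" unfolding F(2) by auto
  ultimately show ?thesis unfolding algebraic_set_def by blast
qed

lemma norm_vec_le_sum: "norm (z :: complex ^ 'n) \<le> (\<Sum>i\<in>UNIV. norm (z $ i))"
  unfolding norm_vec_def by (rule L2_set_le_sum) auto

text \<open>The image is obtained from the graph by eliminating the coordinates of the source.\<close>

lemma algebraic_set_proper_image:
  fixes P :: "complex ^ 'm \<Rightarrow> complex ^ 'n"
  assumes P: "polynomial_map P" and A: "algebraic_set A" and proper: "norm_proper_on A P"
  shows "algebraic_set (P ` A)"
proof -
  define pr :: "('m + 'n \<Rightarrow> complex) \<Rightarrow> complex ^ 'm" where "pr z = (\<chi> i. z (Inl i))" for z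
  define E :: "('m + 'n) set" where "E = range Inl"
  define S :: "('m + 'n) set" where "S = range Inr"
  define G where "G = {z. pr z \<in> A} \<inter> {z. \<forall>f\<in>range (\<lambda>j z. z (Inr j) - P (pr z) $ j). f z = 0}"
  have ES: "E \<inter> S = {}" "E \<union> S = UNIV" unfolding E_def S_def by (auto simp: UNIV_sum)
  have G: "z \<in> G \<longleftrightarrow> pr z \<in> A \<and> (\<forall>j. z (Inr j) = P (pr z) $ j)" for z
    unfolding G_def by auto
  have "polyfun UNIV (\<lambda>z :: 'm + 'n \<Rightarrow> complex. P (pr z) $ j)" for j
  proof -
    have "polyfun UNIV (\<lambda>z. P (vec_lambda z) $ j)"
      using P polyfun_of_complex_polynomial_function[of "\<lambda>z. P z $ j"] unfolding polynomial_map_def by blast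
    from polyfun_compose[OF this, of UNIV "\<lambda>z i. z (Inl i)"] show ?thesis
      unfolding pr_def by (auto intro: polyfun.intros)
  qed
  then have "alg_on UNIV {z. \<forall>f\<in>range (\<lambda>j z. z (Inr j) - P (pr z) $ j). f z = 0}"
    by (intro alg_onI) (auto intro!: polyfun_diff polyfun.coord)
  moreover have "alg_on UNIV {z :: 'm + 'n \<Rightarrow> complex. pr z \<in> A}"
    using alg_on_compose[OF A[unfolded algebraic_set_iff_alg_on], of UNIV "\<lambda>z i. z (Inl i)"]
    unfolding pr_def by (auto intro: polyfun.intros)
  ultimately have alg: "alg_on (E \<union> S) G" unfolding G_def ES by (intro alg_on_Int)
  have "proper_on S E G" unfolding proper_on_def
  proof
    fix R :: real
    \<comment> \<open>Coordinates bounded by \<open>R\<close> give a norm of at most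
      \<open>CARD('n) * R\<close>.\<close>
    obtain M where M: "\<And>z. z \<in> A \<Longrightarrow> norm (P z) \<le> CARD('n) * R \<Longrightarrow> norm z \<le> M"
      using proper unfolding norm_proper_on_def by blast
    have "norm (z (Inl i)) \<le> M" if z: "z \<in> G" "\<forall>i\<in>S. norm (z i) \<le> R" for z i
    proof -
      have "norm (P (pr z)) \<le> (\<Sum>j\<in>UNIV. norm (P (pr z) $ j))" by (rule norm_vec_le_sum)
      also have "\<dots> \<le> (\<Sum>j\<in>(UNIV :: 'n set). R)"
        using z unfolding G S_def by (intro sum_mono) auto
      finally have "norm (pr z) \<le> M" using z(1) unfolding G by (intro M) auto
      moreover have "norm (z (Inl i)) \<le> norm (pr z)"
        using Finite_Cartesian_Product.norm_nth_le[of "pr z" i] by (simp add: pr_def)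
      ultimately show ?thesis by linarith
    qed
    then show "\<exists>M. \<forall>z\<in>G. (\<forall>i\<in>S. norm (z i) \<le> R) \<longrightarrow> (\<forall>i\<in>E. norm (z i) \<le> M)"
      unfolding E_def by blast
  qed
  from alg_on_proper_image[OF _ _ ES(1) alg this]
  have "alg_on S {z. \<exists>w\<in>G. \<forall>i. i \<notin> E \<longrightarrow> w i = z i}" by simp
  \<comment> \<open>The projected set is a cylinder that ignores the source coordinates; they are
    filled with 0.\<close>
  then have "alg_on UNIV {u. case_sum (\<lambda>_. 0) u \<in> {z. \<exists>w\<in>G. \<forall>i. i \<notin> E \<longrightarrow> w i = z i}}"
    by (rule alg_on_compose) (auto simp: S_def intro: polyfun.coord[OF UNIV_I])
  moreover have "case_sum (\<lambda>_. 0) u \<in> {z. \<exists>w\<in>G. \<forall>i. i \<notin> E \<longrightarrow> w i = z i} \<longleftrightarrow>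
      vec_lambda u \<in> P ` A" for u
  proof
    assume "case_sum (\<lambda>_. 0) u \<in> {z. \<exists>w\<in>G. \<forall>i. i \<notin> E \<longrightarrow> w i = z i}"
    then obtain w where w: "w \<in> G" "\<forall>i. i \<notin> E \<longrightarrow> w i = case_sum (\<lambda>_. 0) u i" by blast
    have "w (Inr j) = u j" for j using w(2)[rule_format, of "Inr j"] by (auto simp: E_def)
    then have "vec_lambda u = P (pr w)" using w(1) unfolding G by (simp add: vec_eq_iff)
    then show "vec_lambda u \<in> P ` A" using w(1) unfolding G by blast
  next
    assume "vec_lambda u \<in> P ` A"
    then obtain a where a: "a \<in> A" "vec_lambda u = P a" by blast
    let ?w = "case_sum (vec_nth a) (vec_nth (P a))"
    have "pr ?w = a" unfolding pr_def by (simp add: vec_eq_iff)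
    then have "?w \<in> G" unfolding G using a by simp
    moreover have "?w i = case_sum (\<lambda>_. 0) u i" if "i \<notin> E" for i
      using that a(2)[symmetric] by (cases i) (auto simp: E_def)
    ultimately show "case_sum (\<lambda>_. 0) u \<in> {z. \<exists>w\<in>G. \<forall>i. i \<notin> E \<longrightarrow> w i = z i}" by blast
  qed
  ultimately show ?thesis unfolding algebraic_set_iff_alg_on by simp
qed

text \<open>The function \<open>g\<close> is adjoined to \<open>P\<close> as the coordinate
  \<open>None\<close>. On the image of \<open>X\<close> under the enlarged map this coordinate is
  bounded wherever the others are, since \<open>P\<close> is proper on \<open>X\<close>.\<close>

lemma integral_over_proper_map:
  fixes P :: "complex ^ 'm \<Rightarrow> complex ^ 'n"
  assumes P: "polynomial_map P" and X: "algebraic_set X" and proper: "norm_proper_on X P"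
    and g: "complex_polynomial_function g"
  shows "\<exists>d c. (\<forall>j. complex_polynomial_function (c j)) \<and>
    (\<forall>z\<in>X. g z ^ d + (\<Sum>j<d. c j (P z) * g z ^ j) = 0)"
proof -
  define Q :: "complex ^ 'm \<Rightarrow> complex ^ ('n option)"
    where "Q z = (\<chi> j. case j of None \<Rightarrow> g z | Some a \<Rightarrow> P z $ a)" for z
  have Q: "Q z $ None = g z" "Q z $ Some a = P z $ a" for z a by (simp_all add: Q_def)
  have PQ: "norm (P z) \<le> (\<Sum>a\<in>UNIV. norm (Q z $ Some a))" for z
    unfolding Q by (rule norm_vec_le_sum)
  have "norm_proper_on X Q" unfolding norm_proper_on_def
  proof
    fix R :: real
    obtain M where M: "\<And>z. z \<in> X \<Longrightarrow> norm (P z) \<le> CARD('n) * R \<Longrightarrow> norm z \<le> M"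
      using proper unfolding norm_proper_on_def by blast
    have "norm z \<le> M" if "z \<in> X" "norm (Q z) \<le> R" for z
    proof -
      have "(\<Sum>a\<in>UNIV. norm (Q z $ Some a)) \<le> (\<Sum>a\<in>(UNIV :: 'n set). R)"
        using that(2) Finite_Cartesian_Product.norm_nth_le[of "Q z"]
        by (intro sum_mono) (meson order_trans)
      then show ?thesis using PQ[of z] that(1) by (intro M) auto
    qed
    then show "\<exists>M. \<forall>z\<in>X. norm (Q z) \<le> R \<longrightarrow> norm z \<le> M" by blast
  qed
  moreover have "polynomial_map Q" unfolding polynomial_map_def
  proof
    fix j show "complex_polynomial_function (\<lambda>z. Q z $ j)"
      using P g by (cases j) (auto simp: Q polynomial_map_def)
  qed
  ultimately have "algebraic_set (Q ` X)" using X by (intro algebraic_set_proper_image)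
  then have alg: "alg_on (insert None (range Some)) {u. vec_lambda u \<in> Q ` X}"
    unfolding algebraic_set_iff_alg_on UNIV_option_conv .
  have "proper_on (range Some) {None} {u. vec_lambda u \<in> Q ` X}" unfolding proper_on_def
  proof
    fix R :: real
    obtain M where M: "\<And>z. z \<in> X \<Longrightarrow> norm (P z) \<le> CARD('n) * R \<Longrightarrow> norm z \<le> M"
      using proper unfolding norm_proper_on_def by blast
    obtain N where N: "\<And>z. \<forall>i\<in>UNIV. norm (z i) \<le> M \<Longrightarrow> norm (g (vec_lambda z)) \<le> N"
      using polyfun_bounded[OF polyfun_of_complex_polynomial_function[OF g]] by blast
    have "norm (u None) \<le> N" if u: "vec_lambda u \<in> Q ` X" "\<forall>i\<in>range Some. norm (u i) \<le> R" for u
    proof -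
      obtain z where z: "z \<in> X" "vec_lambda u = Q z" using u(1) by blast
      then have uQ: "u = vec_nth (Q z)" by (metis vec_lambda_inverse UNIV_I)
      have "(\<Sum>a\<in>UNIV. norm (Q z $ Some a)) \<le> (\<Sum>a\<in>(UNIV :: 'n set). R)"
        using u(2) unfolding uQ by (intro sum_mono) auto
      then have "norm z \<le> M" using PQ[of z] z(1) by (intro M) auto
      then have "\<forall>i\<in>UNIV. norm (z $ i) \<le> M"
        using Finite_Cartesian_Product.norm_nth_le[of z] order_trans by blast
      from N[OF this] show ?thesis unfolding uQ Q by simp
    qed
    then show "\<exists>M. \<forall>u\<in>{u. vec_lambda u \<in> Q ` X}. (\<forall>i\<in>range Some. norm (u i) \<le> R) \<longrightarrow>
        (\<forall>i\<in>{None}. norm (u i) \<le> M)" by auto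
  qed
  moreover have "finite (range Some :: 'n option set)" "None \<notin> range Some" by auto
  ultimately obtain F d where F: "polyc (range Some) F"
    "\<forall>u. degree (F u) = d \<and> lead_coeff (F u) = 1"
    "\<forall>u\<in>{u. vec_lambda u \<in> Q ` X}. poly (F u) (u None) = 0"
    using integral_of_proper[of "range Some" None, OF _ _ alg] by metis
  define c where "c j v = coeff (F (case_option 0 (vec_nth v))) j" for j and v :: "complex ^ 'n"
  have "complex_polynomial_function (c j)" for j
  proof -
    have "polyfun UNIV (\<lambda>u. coeff (F (case_option 0 u)) j)"
      by (rule polyfun_compose[OF polyc_coeff[OF F(1)]]) (auto intro: polyfun.coord[OF UNIV_I])
    from complex_polynomial_function_of_polyfun[OF this] show ?thesis unfolding c_def .
  qed
  moreover have "g z ^ d + (\<Sum>j<d. c j (P z) * g z ^ j) = 0" if "z \<in> X" for z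
  proof -
    let ?u = "vec_nth (Q z)"
    have "F ?u = F (case_option 0 (vec_nth (P z)))"
      by (rule polyc_cong[OF F(1)]) (auto simp: Q)
    then have co: "coeff (F ?u) j = c j (P z)" for j unfolding c_def by simp
    have "vec_lambda ?u \<in> Q ` X" using that by simp
    then have "poly (F ?u) (?u None) = 0" using F(3) by blast
    then have "0 = poly (F ?u) (g z)" by (simp add: Q)
    also have "\<dots> = (\<Sum>j\<le>d. coeff (F ?u) j * g z ^ j)"
      using F(2) by (intro poly_altdef') auto
    also have "\<dots> = (\<Sum>j<d. coeff (F ?u) j * g z ^ j) + coeff (F ?u) d * g z ^ d"
      by (simp flip: lessThan_Suc_atMost)
    also have "coeff (F ?u) d = 1" using F(2) by metis
    finally show ?thesis unfolding co by (simp add: add.commute)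
  qed
  ultimately show ?thesis by blast
qed

section \<open>Irreducible sets and dimension under proper maps\<close>

lemma irreducible_proper_image:
  assumes P: "polynomial_map P" and A: "irreducible_algebraic_set A" and proper: "norm_proper_on A P"
  shows "irreducible_algebraic_set (P ` A)"
  unfolding irreducible_algebraic_set_def
proof (intro conjI allI impI)
  show "algebraic_set (P ` A)" "P ` A \<noteq> {}"
    using algebraic_set_proper_image[OF P irreducible_algebraic[OF A] proper]
      irreducible_nonempty[OF A] by auto
  fix B C assume BC: "algebraic_set B" "algebraic_set C" "P ` A = B \<union> C"
  then have "A \<subseteq> {z. P z \<in> B} \<union> {z. P z \<in> C}" by auto
  then have "A \<subseteq> {z. P z \<in> B} \<or> A \<subseteq> {z. P z \<in> C}"
    using BC P A by (intro irreducible_subset_Un algebraic_set_preimage) auto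
  then have "P ` A \<subseteq> B \<or> P ` A \<subseteq> C" by blast
  then show "P ` A = B \<or> P ` A = C" using BC(3) by blast
qed

text \<open>The preimage of \<open>D\<close> in \<open>A\<close> has finitely many irreducible
  pieces. Their images are algebraic and cover \<open>D\<close>, so one of them contains
  \<open>D\<close>.\<close>

lemma irreducible_lift:
  assumes P: "polynomial_map P" and A: "algebraic_set A" and proper: "norm_proper_on A P"
    and D: "irreducible_algebraic_set D" "D \<subseteq> P ` A"
  shows "\<exists>C. irreducible_algebraic_set C \<and> C \<subseteq> A \<and> P ` C = D"
proof -
  let ?B = "A \<inter> {z. P z \<in> D}"
  have "algebraic_set ?B"
    using A D(1) P by (intro algebraic_set_Int algebraic_set_preimage)
      (auto intro: irreducible_algebraic)
  from irreducible_decomposition[OF this] obtain F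
    where F: "finite F" "\<forall>B\<in>F. irreducible_algebraic_set B" "?B = \<Union>F" by (elim exE conjE)
  have "algebraic_set (P ` C)" if "C \<in> F" for C
  proof (rule algebraic_set_proper_image[OF P])
    show "algebraic_set C" using F(2) that irreducible_algebraic by blast
    show "norm_proper_on C P" using F(3) that by (intro norm_proper_on_subset[OF proper]) blast
  qed
  moreover have "D \<subseteq> \<Union>((`) P ` F)"
  proof
    fix d assume "d \<in> D"
    then obtain z where "z \<in> ?B" "d = P z" using D(2) by blast
    then show "d \<in> \<Union>((`) P ` F)" unfolding F(3) by blast
  qed
  ultimately obtain C where C: "C \<in> F" "D \<subseteq> P ` C"
    using irreducible_subset_Union[OF D(1), of "(`) P ` F"] F(1) by blast
  have "C \<subseteq> ?B" using C(1) F(3) by blast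
  then have "P ` C = D" "C \<subseteq> A" using C(2) by auto
  then show ?thesis using F(2) C(1) by blast
qed

text \<open>Otherwise take \<open>f\<close> vanishing on \<open>A\<close> but not on \<open>B\<close>, and an integral equation for \<open>f\<close> on \<open>B\<close>
  of minimal degree. Its constant coefficient vanishes on the image, so a factor \<open>f\<close> can be
  cancelled.\<close>

lemma irreducible_eq_of_proper_image_eq:
  assumes P: "polynomial_map P" and A: "algebraic_set A" and B: "irreducible_algebraic_set B"
    and proper: "norm_proper_on B P" and "A \<subseteq> B" "P ` A = P ` B"
  shows "A = B"
proof (rule ccontr)
  assume "A \<noteq> B"
  then obtain b where "b \<in> B" "b \<notin> A" using \<open>A \<subseteq> B\<close> by blast
  then obtain f where f: "complex_polynomial_function f" "f b \<noteq> 0" "\<And>z. z \<in> A \<Longrightarrow> f z = 0"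
    using A unfolding algebraic_set_def by auto
  define Q where "Q d \<longleftrightarrow> (\<exists>c. (\<forall>j. complex_polynomial_function (c j)) \<and>
    (\<forall>z\<in>B. f z ^ d + (\<Sum>j<d. c j (P z) * f z ^ j) = 0))" for d
  have "algebraic_set B" by (rule irreducible_algebraic[OF B])
  then have "\<exists>d. Q d" using integral_over_proper_map[OF P _ proper f(1)] unfolding Q_def by blast
  then obtain d where d: "Q d" "\<And>e. e < d \<Longrightarrow> \<not> Q e" using exists_least_iff[of Q] by blast
  obtain c where c: "\<And>j. complex_polynomial_function (c j)"
    "\<And>z. z \<in> B \<Longrightarrow> f z ^ d + (\<Sum>j<d. c j (P z) * f z ^ j) = 0"
    using d(1) unfolding Q_def by blast
  have "d \<noteq> 0" using c(2)[OF \<open>b \<in> B\<close>] by (intro notI) simp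
  then obtain e where e: "d = Suc e" using not0_implies_Suc by blast
  have eq: "f z ^ d + (\<Sum>j<d. c j (P z) * f z ^ j) =
      c 0 (P z) + f z * (f z ^ e + (\<Sum>j<e. c (Suc j) (P z) * f z ^ j))" for z
    unfolding e sum.lessThan_Suc_shift by (simp add: algebra_simps sum_distrib_left)
  \<comment> \<open>At a point of \<open>A\<close> with the same image \<open>f\<close> vanishes,
    and the equation reduces to its constant coefficient.\<close>
  have c0: "c 0 (P z) = 0" if "z \<in> B" for z
  proof -
    have "P z \<in> P ` A" unfolding \<open>P ` A = P ` B\<close> using that by (rule imageI)
    then obtain a where a: "a \<in> A" "P z = P a" by (elim imageE)
    then show ?thesis using c(2)[of a] eq[of a] f(3)[OF a(1)] \<open>A \<subseteq> B\<close> by auto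
  qed
  let ?h = "\<lambda>z. f z ^ e + (\<Sum>j<e. c (Suc j) (P z) * f z ^ j)"
  have sum: "complex_polynomial_function (\<lambda>z. \<Sum>j<n. h j z)"
    if "\<And>j. complex_polynomial_function (h j)" for n and h :: "nat \<Rightarrow> complex ^ 'a \<Rightarrow> complex"
    by (induction n) (auto intro: complex_polynomial_function.intros that)
  have pow: "complex_polynomial_function (\<lambda>z. f z ^ n)" for n
    by (induction n) (auto intro: complex_polynomial_function.intros f(1))
  have "complex_polynomial_function ?h"
    by (intro complex_polynomial_function.add complex_polynomial_function.mult sum pow
        complex_polynomial_function_compose[OF c(1) P])
  moreover have "\<forall>z\<in>B. f z * ?h z = 0" using c(2) eq c0 by simp
  ultimately have "\<forall>z\<in>B. ?h z = 0"
    using irreducible_mult_eq_0[OF B f(1)] f(2) \<open>b \<in> B\<close> by blast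
  then have "Q e" unfolding Q_def using c(1) by (intro exI[of _ "\<lambda>j. c (Suc j)"]) blast
  then show False using d(2)[of e] e by simp
qed

text \<open>The largest member is lifted to \<open>C\<close>, and the rest of the chain is then
  lifted inside \<open>C\<close>. Strictness is inherited from the images.\<close>

lemma irreducible_chain_lift:
  assumes P: "polynomial_map P" and "algebraic_set A" and "norm_proper_on A P"
    and "\<forall>j\<le>n. irreducible_algebraic_set (Z j) \<and> Z j \<subseteq> P ` A" "\<forall>j<n. Z j \<subset> Z (Suc j)"
  shows "\<exists>Y. (\<forall>j\<le>n. irreducible_algebraic_set (Y j) \<and> Y j \<subseteq> A) \<and> (\<forall>j<n. Y j \<subset> Y (Suc j)) \<and>
    (\<forall>j\<le>n. P ` Y j = Z j)"
  using assms(2-)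
proof (induction n arbitrary: A)
  case 0
  then obtain C where "irreducible_algebraic_set C" "C \<subseteq> A" "P ` C = Z 0"
    using irreducible_lift[OF P, of A "Z 0"] by auto
  then show ?case by (intro exI[of _ "\<lambda>_. C"]) auto
next
  case (Suc n)
  then obtain C where C: "irreducible_algebraic_set C" "C \<subseteq> A" "P ` C = Z (Suc n)"
    using irreducible_lift[OF P, of A "Z (Suc n)"] by auto
  have mono: "Z j \<subseteq> Z (Suc n)" if "j \<le> n" for j
  proof -
    have "j \<le> Suc n \<Longrightarrow> Z j \<subseteq> Z (Suc n)"
      by (induction rule: inc_induct) (use Suc(5) in auto)
    then show ?thesis using that by simp
  qed
  have "\<exists>Y. (\<forall>j\<le>n. irreducible_algebraic_set (Y j) \<and> Y j \<subseteq> C) \<and> (\<forall>j<n. Y j \<subset> Y (Suc j)) \<and>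
    (\<forall>j\<le>n. P ` Y j = Z j)"
    using C Suc(3-) mono norm_proper_on_subset
    by (intro Suc(1)) (auto intro: irreducible_algebraic)
  then obtain Y where Y: "\<forall>j\<le>n. irreducible_algebraic_set (Y j) \<and> Y j \<subseteq> C"
    "\<forall>j<n. Y j \<subset> Y (Suc j)" "\<forall>j\<le>n. P ` Y j = Z j" by blast
  have "Y n \<noteq> C" using C(3) Y(3) Suc(5) by auto
  then have n: "Y n \<subset> C" using Y(1) by blast
  define Y' where "Y' = Y(Suc n := C)"
  have "\<forall>j\<le>Suc n. irreducible_algebraic_set (Y' j) \<and> Y' j \<subseteq> A"
    using Y(1) C unfolding Y'_def by (auto simp: le_Suc_eq)
  moreover have "\<forall>j<Suc n. Y' j \<subset> Y' (Suc j)"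
    using Y(2) n unfolding Y'_def by (auto simp: less_Suc_eq)
  moreover have "\<forall>j\<le>Suc n. P ` Y' j = Z j"
    using Y(3) C(3) unfolding Y'_def by (auto simp: le_Suc_eq)
  ultimately show ?case by blast
qed

text \<open>Chains lift from the image, and chains in \<open>A\<close> have strict images because a
  proper algebraic subset of an irreducible set has a smaller image.\<close>

theorem algebraic_dim_proper_image:
  assumes P: "polynomial_map P" and A: "algebraic_set A" and proper: "norm_proper_on A P"
  shows "algebraic_dim (P ` A) = algebraic_dim A"
proof -
  let ?chain = "\<lambda>A n Z. (\<forall>j\<le>n. irreducible_algebraic_set (Z j) \<and> Z j \<subseteq> A) \<and>
    (\<forall>j<n. Z j \<subset> Z (Suc j))"
  have "(\<exists>Z. ?chain (P ` A) n Z) \<longleftrightarrow> (\<exists>Z. ?chain A n Z)" for n :: nat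
  proof
    assume "\<exists>Z. ?chain (P ` A) n Z"
    then obtain Z where "\<forall>j\<le>n. irreducible_algebraic_set (Z j) \<and> Z j \<subseteq> P ` A"
      "\<forall>j<n. Z j \<subset> Z (Suc j)" by (elim exE conjE)
    from irreducible_chain_lift[OF P A proper this] show "\<exists>Z. ?chain A n Z"
      by (elim exE conjE) (intro exI conjI)
  next
    assume "\<exists>Z. ?chain A n Z"
    then obtain Z where Z: "\<And>j. j \<le> n \<Longrightarrow> irreducible_algebraic_set (Z j)"
      "\<And>j. j \<le> n \<Longrightarrow> Z j \<subseteq> A" "\<And>j. j < n \<Longrightarrow> Z j \<subset> Z (Suc j)" by blast
    have Zprop: "norm_proper_on (Z j) P" if "j \<le> n" for j
      by (rule norm_proper_on_subset[OF proper Z(2)[OF that]])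
    have strict: "P ` Z j \<subset> P ` Z (Suc j)" if "j < n" for j
    proof -
      have "P ` Z j \<noteq> P ` Z (Suc j)"
        using irreducible_eq_of_proper_image_eq[OF P _ Z(1) Zprop, of "Z j" "Suc j"] Z(1)[of j]
          Z(3)[OF that] that irreducible_algebraic by auto
      then show ?thesis using Z(3)[OF that] by blast
    qed
    have image: "irreducible_algebraic_set (P ` Z j) \<and> P ` Z j \<subseteq> P ` A" if "j \<le> n" for j
      using irreducible_proper_image[OF P Z(1)[OF that] Zprop[OF that]] image_mono[OF Z(2)[OF that]]
      by (rule conjI)
    show "\<exists>Z. ?chain (P ` A) n Z"
      by (rule exI[of _ "\<lambda>j. P ` Z j"], rule conjI; intro allI impI; erule image strict)
  qed
  then show ?thesis unfolding algebraic_dim_def by simp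
qed

text \<open>A component of the image lifts to an irreducible set, which lies in a component
  \<open>C\<close> of \<open>X\<close>. The image of \<open>C\<close> is irreducible and contains
  the given component, so by maximality the two agree.\<close>

theorem pure_dimensional_proper_image:
  assumes P: "polynomial_map P" and X: "pure_dimensional_algebraic_set k X"
    and proper: "norm_proper_on X P"
  shows "pure_dimensional_algebraic_set k (P ` X)"
  unfolding pure_dimensional_algebraic_set_def
proof (intro conjI allI impI)
  have alg: "algebraic_set X" using X unfolding pure_dimensional_algebraic_set_def by blast
  show "algebraic_set (P ` X)" by (rule algebraic_set_proper_image[OF P alg proper])
  fix D assume "irreducible_component_of D (P ` X)"
  then have D: "irreducible_algebraic_set D" "D \<subseteq> P ` X"
    "\<And>E. irreducible_algebraic_set E \<Longrightarrow> D \<subseteq> E \<Longrightarrow> E \<subseteq> P ` X \<Longrightarrow> E = D"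
    unfolding irreducible_component_of_def by auto
  obtain A where A: "irreducible_algebraic_set A" "A \<subseteq> X" "P ` A = D"
    using irreducible_lift[OF P alg proper D(1,2)] by blast
  obtain C where C: "irreducible_component_of C X" "A \<subseteq> C"
    using irreducible_subset_component[OF alg A(1,2)] by blast
  then have "C \<subseteq> X" "irreducible_algebraic_set C" unfolding irreducible_component_of_def by auto
  moreover have propC: "norm_proper_on C P" by (rule norm_proper_on_subset[OF proper \<open>C \<subseteq> X\<close>])
  ultimately have "P ` C = D"
    using A(3) C(2) irreducible_proper_image[OF P _ propC] by (intro D(3)) auto
  moreover have "algebraic_set C"
    by (rule irreducible_algebraic[OF \<open>irreducible_algebraic_set C\<close>])
  ultimately have "algebraic_dim D = algebraic_dim C"
    using algebraic_dim_proper_image[OF P _ propC] by simp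
  then show "algebraic_dim D = enat k"
    using X C(1) unfolding pure_dimensional_algebraic_set_def by simp
qed

section \<open>Behaviour at infinity\<close>

lemma continuous_polynomial_map:
  assumes "polynomial_map P" shows "continuous_on S P"
proof -
  have "continuous_on S (\<lambda>z. \<chi> j. P z $ j)"
    using assms continuous_complex_polynomial_function continuous_on_subset
    unfolding polynomial_map_def by (intro continuous_on_vec_lambda) blast
  then show ?thesis by simp
qed

lemma closed_norm_proper_image:
  fixes P :: "'a::euclidean_space \<Rightarrow> 'b::real_normed_vector"
  assumes "continuous_on UNIV P" "norm_proper_on X P" "closed X"
  shows "closed (P ` X)"
  unfolding closed_sequential_limits
proof (intro allI impI)
  fix b l assume bl: "(\<forall>n. b n \<in> P ` X) \<and> b \<longlonglongrightarrow> l"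
  then have "\<forall>n. \<exists>p. p \<in> X \<and> b n = P p" by blast
  then obtain p where p: "\<And>n. p n \<in> X" "\<And>n. b n = P (p n)" by metis
  have "Bseq b" using bl by (auto intro: convergent_imp_Bseq convergentI)
  then obtain R where "\<And>n. norm (b n) \<le> R" unfolding Bseq_def by blast
  then obtain M where M: "\<And>n. norm (p n) \<le> M"
    using assms(2) p unfolding norm_proper_on_def by metis
  have "compact (X \<inter> cball 0 M)" using assms(3) by (simp add: closed_Int_compact)
  moreover have "\<forall>n. p n \<in> X \<inter> cball 0 M" using p M by simp
  ultimately obtain a r where a: "a \<in> X \<inter> cball 0 M" "strict_mono r" "(p \<circ> r) \<longlonglongrightarrow> a"
    by (rule seq_compactE[OF compact_imp_seq_compact])
  have "(\<lambda>n. P ((p \<circ> r) n)) \<longlonglongrightarrow> P a"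
    by (rule continuous_on_tendsto_compose[OF assms(1) a(3)]) auto
  moreover have "(\<lambda>n. P ((p \<circ> r) n)) \<longlonglongrightarrow> l"
    using LIMSEQ_subseq_LIMSEQ[OF _ a(2), of b l] bl p(2) by (simp add: o_def)
  ultimately have "l = P a" using LIMSEQ_unique by blast
  then show "l \<in> P ` X" using a(1) by blast
qed

text \<open>The closed subset \<open>X \<inter> {z. norm z \<ge> R}\<close> has closed image, and injectivity extends slightly
  beyond it.\<close>

lemma homeomorphism_outside_ball:
  fixes P :: "'a::euclidean_space \<Rightarrow> 'b::real_normed_vector"
  assumes cont: "continuous_on UNIV P" and proper: "norm_proper_on X P" and "closed X"
    and inj: "\<And>p q. p \<in> X \<Longrightarrow> q \<in> X \<Longrightarrow> norm p > r \<Longrightarrow> norm q > r \<Longrightarrow> P p = P q \<Longrightarrow> p = q"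
    and "R > r"
  shows "\<exists>g. homeomorphism (X - cball 0 R) (P ` (X - cball 0 R)) P g"
proof -
  let ?S = "X - cball 0 R"
  have S: "p \<in> ?S \<longleftrightarrow> p \<in> X \<and> norm p > R" for p by auto
  have injS: "inj_on P ?S" unfolding S inj_on_def using inj \<open>R > r\<close> by auto
  have "closedin (top_of_set (P ` ?S)) (P ` U)" if "closedin (top_of_set ?S) U" for U
  proof -
    from that obtain C where C: "closed C" "U = ?S \<inter> C"
      unfolding closedin_closed by (elim exE conjE)
    let ?K = "X \<inter> C \<inter> {z. norm z \<ge> R}"
    have "closed ?K" using C(1) \<open>closed X\<close> by (intro closed_Int closed_Collect_le continuous_intros) auto
    moreover have "norm_proper_on ?K P" by (rule norm_proper_on_subset[OF proper]) auto
    ultimately have "closed (P ` ?K)" by (intro closed_norm_proper_image[OF cont])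
    \<comment> \<open>The closed set may contain points of norm exactly \<open>R\<close>. As
      \<open>r < R\<close>, injectivity also prevents these from sharing an image with a point
      outside the ball.\<close>
    moreover have "P ` U = P ` ?S \<inter> P ` ?K"
    proof
      show "P ` U \<subseteq> P ` ?S \<inter> P ` ?K" unfolding C(2) by auto
      show "P ` ?S \<inter> P ` ?K \<subseteq> P ` U"
      proof
        fix b assume "b \<in> P ` ?S \<inter> P ` ?K"
        then obtain p q where pq: "p \<in> ?S" "q \<in> ?K" "b = P p" "b = P q" by blast
        then have "p = q" using \<open>R > r\<close> by (intro inj) auto
        then show "b \<in> P ` U" using pq unfolding C(2) by blast
      qed
    qed
    ultimately show ?thesis by (auto simp: closedin_closed)
  qed
  with continuous_on_subset[OF cont] injS show ?thesis
    by (meson homeomorphism_injective_closed_map subset_UNIV)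
qed

section \<open>Tangent cones, properness and injectivity\<close>

lemma scaleR_eq_vector_smult: "r *\<^sub>R v = complex_of_real r *s v"
  by (subst vec_eq_iff) (simp flip: scaleR_conv_of_real)

text \<open>The factors \<open>1 / norm (p n)\<close> become the scalars in the definitions of both
  cones.\<close>

lemma unit_sequence_limit:
  fixes p :: "nat \<Rightarrow> complex ^ 'n"
  assumes "\<And>n. p n \<noteq> 0"
  shows "\<exists>v r. strict_mono r \<and> (\<lambda>n. complex_of_real (1 / norm (p (r n))) *s p (r n)) \<longlonglongrightarrow> v \<and> v \<noteq> 0"
proof -
  let ?u = "\<lambda>n. complex_of_real (1 / norm (p n)) *s p n"
  have "?u n = (1 / norm (p n)) *\<^sub>R p n" for n by (rule scaleR_eq_vector_smult[symmetric])
  then have "\<forall>n. ?u n \<in> sphere 0 1" using assms by simp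
  then obtain v r where v: "v \<in> sphere 0 1" "strict_mono r" "(?u \<circ> r) \<longlonglongrightarrow> v"
    by (rule seq_compactE[OF compact_imp_seq_compact[OF compact_sphere]])
  have "v \<noteq> 0" using v(1) by auto
  then show ?thesis using v(2,3) unfolding o_def by blast
qed

lemma filterlim_norm_at_top:
  assumes "\<And>n. norm (p n) > real n" shows "filterlim (\<lambda>n. norm (p n)) at_top sequentially"
  by (intro filterlim_at_top_mono[OF filterlim_real_sequentially] always_eventually allI
      less_imp_le assms)

lemma norm_proper_on_of_C3_inf:
  fixes P :: "complex ^ 'm \<Rightarrow> complex ^ 'n"
  assumes cont: "continuous_on UNIV P" and scale: "\<And>c z. P (c *s z) = c *s P z"
    and C3: "\<And>v. v \<in> C3_inf X \<Longrightarrow> P v = 0 \<Longrightarrow> v = 0"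
  shows "norm_proper_on X P"
proof (rule ccontr)
  assume "\<not> norm_proper_on X P"
  then obtain R where R: "\<And>M. \<exists>z\<in>X. norm (P z) \<le> R \<and> norm z > M"
    unfolding norm_proper_on_def by (metis not_le)
  \<comment> \<open>With \<open>Suc n\<close> the rescaled images are bounded by a multiple of
    \<open>inverse (real (Suc n))\<close> for every \<open>n\<close>.\<close>
  then have "\<forall>n. \<exists>z. z \<in> X \<and> norm (P z) \<le> R \<and> norm z > real (Suc n)" by blast
  then obtain p where p: "\<And>n. p n \<in> X" "\<And>n. norm (P (p n)) \<le> R" "\<And>n. norm (p n) > real (Suc n)"
    by metis
  have "p n \<noteq> 0" for n using p(3)[of n] by auto
  then obtain v r where v: "strict_mono r" "v \<noteq> 0"
    "(\<lambda>n. complex_of_real (1 / norm (p (r n))) *s p (r n)) \<longlonglongrightarrow> v" (is "?u \<longlonglongrightarrow> v")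
    using unit_sequence_limit[of p] by blast
  have large: "norm (p (r n)) > real (Suc n)" for n
    using p(3)[of "r n"] strict_mono_imp_increasing[OF v(1), of n] by linarith
  have "v \<in> C3_inf X" unfolding C3_inf_def
  proof (intro CollectI exI conjI allI)
    show "p (r n) \<in> X" for n by (rule p(1))
    have "norm (p (r n)) > real n" for n using large[of n] by linarith
    then show "filterlim (\<lambda>n. norm (p (r n))) at_top sequentially" by (rule filterlim_norm_at_top)
  qed (rule v(3))
  moreover have "P v = 0"
  proof -
    have "(\<lambda>n. P (?u n)) \<longlonglongrightarrow> P v"
      by (rule continuous_on_tendsto_compose[OF cont v(3)]) auto
    moreover have "(\<lambda>n. P (?u n)) \<longlonglongrightarrow> 0"
    proof (rule Lim_null_comparison)
      show "\<forall>\<^sub>F n in sequentially. norm (P (?u n)) \<le> \<bar>R\<bar> * inverse (real (Suc n))"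
      proof (intro always_eventually allI)
        fix n
        have "P (?u n) = (1 / norm (p (r n))) *\<^sub>R P (p (r n))"
          unfolding scale by (rule scaleR_eq_vector_smult[symmetric])
        then have "norm (P (?u n)) = norm (P (p (r n))) * inverse (norm (p (r n)))"
          by (simp add: field_simps)
        also have "\<dots> \<le> \<bar>R\<bar> * inverse (real (Suc n))"
          using p(2)[of "r n"] large[of n] by (intro mult_mono le_imp_inverse_le) auto
        finally show "norm (P (?u n)) \<le> \<bar>R\<bar> * inverse (real (Suc n))" .
      qed
      show "(\<lambda>n. \<bar>R\<bar> * inverse (real (Suc n))) \<longlonglongrightarrow> 0"
        by (intro tendsto_mult_right_zero LIMSEQ_inverse_real_of_nat)
    qed
    ultimately show ?thesis using LIMSEQ_unique by blast
  qed
  ultimately show False using C3 v(2) by blast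
qed

lemma inj_at_infinity_of_C5_inf:
  fixes P :: "complex ^ 'm \<Rightarrow> complex ^ 'n"
  assumes cont: "continuous_on UNIV P" and scale: "\<And>c z. P (c *s z) = c *s P z"
    and diff: "\<And>p q. P (p - q) = P p - P q"
    and C5: "\<And>v. v \<in> C5_inf X \<Longrightarrow> P v = 0 \<Longrightarrow> v = 0"
  shows "\<exists>r. \<forall>p\<in>X. \<forall>q\<in>X. norm p > r \<longrightarrow> norm q > r \<longrightarrow> P p = P q \<longrightarrow> p = q"
proof (rule ccontr)
  assume "\<not> ?thesis"
  then have "\<forall>n. \<exists>p q. p \<in> X \<and> q \<in> X \<and> norm p > real n \<and> norm q > real n \<and> P p = P q \<and> p \<noteq> q"
    by blast
  then obtain p q where pq: "\<And>n. p n \<in> X" "\<And>n. q n \<in> X" "\<And>n. norm (p n) > real n"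
    "\<And>n. norm (q n) > real n" "\<And>n. P (p n) = P (q n)" "\<And>n. p n \<noteq> q n" by metis
  obtain v r where v: "strict_mono r" "v \<noteq> 0"
    "(\<lambda>n. complex_of_real (1 / norm (p (r n) - q (r n))) *s (p (r n) - q (r n))) \<longlonglongrightarrow> v"
    (is "?u \<longlonglongrightarrow> v")
    using unit_sequence_limit[of "\<lambda>n. p n - q n"] pq(6) by auto
  have large: "norm (p (r n)) > real n" "norm (q (r n)) > real n" for n
    using pq(3,4)[of "r n"] strict_mono_imp_increasing[OF v(1), of n] by linarith+
  have "v \<in> C5_inf X" unfolding C5_inf_def
  proof (intro CollectI exI conjI allI)
    show "p (r n) \<in> X" "q (r n) \<in> X" for n by (rule pq)+
    show "filterlim (\<lambda>n. norm (p (r n))) at_top sequentially"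
      "filterlim (\<lambda>n. norm (q (r n))) at_top sequentially"
      by (rule filterlim_norm_at_top, rule large)+
  qed (rule v(3))
  moreover have "P v = 0"
  proof -
    have "(\<lambda>n. P (?u n)) \<longlonglongrightarrow> P v"
      by (rule continuous_on_tendsto_compose[OF cont v(3)]) auto
    moreover have "(\<lambda>n. P (?u n)) = (\<lambda>n. 0)" unfolding scale diff pq(5) by simp
    ultimately have "(\<lambda>n. 0) \<longlonglongrightarrow> P v" by simp
    then show ?thesis by (simp only: LIMSEQ_const_iff)
  qed
  ultimately show False using C5 v(2) by blast
qed


section \<open>Linear coordinates\<close>

lemma complex_polynomial_function_linear:
  fixes h :: "complex ^ 'm \<Rightarrow> complex"
  assumes add: "\<And>a b. h (a + b) = h a + h b" and scale: "\<And>c a. h (c *s a) = c * h a"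
  shows "complex_polynomial_function h"
proof -
  have sum: "h (\<Sum>i\<in>I. f i) = (\<Sum>i\<in>I. h (f i))" if "finite I" for I and f :: "'m \<Rightarrow> complex ^ 'm"
    using that by (induction rule: finite_induct) (use add scale[of 0 0] in auto)
  have "h z = (\<Sum>i\<in>UNIV. z $ i * h (axis i 1))" for z
    by (subst basis_expansion[of z, symmetric], subst sum) (simp_all add: scale)
  moreover have "complex_polynomial_function (\<lambda>z. \<Sum>i\<in>I. z $ i * h (axis i 1))" if "finite I" for I
    using that
    by (induction rule: finite_induct)
      (simp_all add: complex_polynomial_function.add complex_polynomial_function.mult
        complex_polynomial_function.coord complex_polynomial_function.const)
  ultimately show ?thesis by (metis (no_types, lifting) ext finite)
qed

lemma subspace_hermitian_complement: "vec.subspace (hermitian_complement W)"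
proof (rule vec.subspaceI)
  show "0 \<in> hermitian_complement W" by (simp add: hermitian_complement_def)
next
  fix a b assume "a \<in> hermitian_complement W" "b \<in> hermitian_complement W"
  then show "a + b \<in> hermitian_complement W"
    by (simp add: hermitian_complement_def distrib_right sum.distrib)
next
  fix c a assume "a \<in> hermitian_complement W"
  then show "c *s a \<in> hermitian_complement W"
    by (simp add: hermitian_complement_def mult.assoc flip: sum_distrib_left)
qed

text \<open>The kernel contains \<open>W\<close> and meets \<open>V\<close> only in 0. Since
  \<open>V\<close> has the dimension of the target of \<open>x\<close>, the dimension of the kernel
  is at most that of \<open>W\<close>.\<close>

lemma kernel_eq_of_complement:
  fixes x :: "complex ^ 'm \<Rightarrow> complex ^ 'k"
  assumes lin: "Vector_Spaces.linear (*s) (*s) x" and V: "vec.subspace V" "bij_betw x V UNIV"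
    and W: "vec.subspace W" "vec.dim W = CARD('m) - CARD('k)" "\<And>w. w \<in> W \<Longrightarrow> x w = 0"
  shows "{z. x z = 0} = W"
proof -
  let ?K = "{z. x z = 0}"
  have K: "vec.subspace ?K" by (rule vec.linear_subspace_kernel[OF lin])
  have x0: "x 0 = 0" by (rule vec.linear_0[OF lin])
  have inj: "inj_on x V" using V(2) by (rule bij_betw_imp_inj_on)
  then have "vec.dim (x ` V) = vec.dim V"
    using V(1) by (intro vec.dim_image_eq[OF lin]) (simp add: vec.span_eq_iff[THEN iffD2])
  then have dimV: "vec.dim V = CARD('k)"
    unfolding bij_betw_imp_surj_on[OF V(2)] vec_dim_card by (rule sym)
  have "?K \<inter> V = {0}"
  proof
    show "?K \<inter> V \<subseteq> {0}"
      using inj_onD[OF inj, of _ 0] vec.subspace_0[OF V(1)] x0 by auto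
    show "{0} \<subseteq> ?K \<inter> V" using vec.subspace_0[OF V(1)] x0 by simp
  qed
  then have "vec.dim {a + b |a b. a \<in> ?K \<and> b \<in> V} = vec.dim ?K + vec.dim V"
    using vec.dim_sums_Int[OF K V(1)] by (simp add: vec.dim_eq_0)
  moreover have "vec.dim {a + b |a b. a \<in> ?K \<and> b \<in> V} \<le> CARD('m)"
    by (rule dim_subset_UNIV_cart_gen)
  ultimately have "vec.dim ?K \<le> vec.dim W" unfolding W(2) dimV by linarith
  moreover have "W \<subseteq> ?K" using W(3) by blast
  ultimately show ?thesis using vec.subspace_dim_equal[OF W(1) K] by simp
qed

theorem theorem1p3:
  fixes X V W :: "(complex ^ 'm) set"
    and x :: "complex ^ 'm \<Rightarrow> complex ^ 'k"
    and y :: "complex ^ 'm \<Rightarrow> complex ^ 'l"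
    and i :: 'l
  assumes "\<not> bounded X"
    and "pure_dimensional_algebraic_set CARD('k) X"
    and "vec.subspace W"
    and "vec.dim W = CARD('m) - CARD('k)"
    and "W \<inter> C3_inf X = {0}"
    and "V = hermitian_complement W"
    and "linear_coordinates V W x y"
    and "C5_inf X \<inter> {z. x z = 0 \<and> y z $ i = 0} = {0}"
  shows "algebraic_hypersurface (coordinate_projection x y i ` X) \<and>
    (\<forall>\<^sub>F R in at_top. \<exists>g.
       homeomorphism (X - cball 0 R) (coordinate_projection x y i ` (X - cball 0 R))
         (coordinate_projection x y i) g)"
proof -
  let ?P = "coordinate_projection x y i"
  have lx: "Vector_Spaces.linear (*s) (*s) x" and ly: "Vector_Spaces.linear (*s) (*s) y"
    and Vx: "bij_betw x V UNIV" and Wx: "\<And>w. w \<in> W \<Longrightarrow> x w = 0"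
    using assms(7) unfolding linear_coordinates_def by auto
  \<comment> \<open>Hence the kernel of the projection lies in \<open>W\<close>, where the
    hypothesis on \<open>C3_inf X\<close> applies.\<close>
  have ker: "{z. x z = 0} = W"
    using subspace_hermitian_complement assms(6)
    by (intro kernel_eq_of_complement[OF lx _ Vx assms(3,4) Wx]) auto
  have P: "?P z $ None = y z $ i" "?P z $ Some a = x z $ a" for z a
    by (simp_all add: coordinate_projection_def)
  have P_eqI: "?P u = v" if "y u $ i = v $ None" "\<And>a. x u $ a = v $ Some a" for u v
    unfolding vec_eq_iff using that P by (metis option.exhaust)
  have P0: "?P v = 0 \<longleftrightarrow> x v = 0 \<and> y v $ i = 0" for v
  proof
    assume "?P v = 0"
    then have "?P v $ j = 0" for j by simp
    then show "x v = 0 \<and> y v $ i = 0" using P by (simp add: vec_eq_iff) metis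
  next
    assume "x v = 0 \<and> y v $ i = 0"
    then show "?P v = 0" by (intro P_eqI) auto
  qed
  have scale: "?P (c *s z) = c *s ?P z" for c z
    by (rule P_eqI) (simp_all add: P vec.linear_scale[OF lx] vec.linear_scale[OF ly])
  have add: "?P (a + b) = ?P a + ?P b" for a b
    by (rule P_eqI) (simp_all add: P vec.linear_add[OF lx] vec.linear_add[OF ly])
  have diff: "?P (a - b) = ?P a - ?P b" for a b
    by (rule P_eqI) (simp_all add: P vec.linear_diff[OF lx] vec.linear_diff[OF ly])
  have poly: "polynomial_map ?P" unfolding polynomial_map_def
    by (intro allI complex_polynomial_function_linear) (simp_all add: add scale)
  have cont: "continuous_on UNIV ?P" by (rule continuous_polynomial_map[OF poly])
  have "v = 0" if "v \<in> C3_inf X" "?P v = 0" for v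
    using that assms(5) ker P0 by auto
  then have proper: "norm_proper_on X ?P" by (rule norm_proper_on_of_C3_inf[OF cont scale])
  have "v = 0" if "v \<in> C5_inf X" "?P v = 0" for v
    using that assms(8) P0 by auto
  then have "\<exists>r. \<forall>p\<in>X. \<forall>q\<in>X. norm p > r \<longrightarrow> norm q > r \<longrightarrow> ?P p = ?P q \<longrightarrow> p = q"
    by (rule inj_at_infinity_of_C5_inf[OF cont scale diff])
  then obtain r where "\<And>p q. p \<in> X \<Longrightarrow> q \<in> X \<Longrightarrow> norm p > r \<Longrightarrow> norm q > r \<Longrightarrow> ?P p = ?P q \<Longrightarrow> p = q"
    by blast
  moreover have "closed X"
    using assms(2) closed_algebraic_set unfolding pure_dimensional_algebraic_set_def by blast
  ultimately have homeo: "\<exists>g. homeomorphism (X - cball 0 R) (?P ` (X - cball 0 R)) ?P g"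
    if "R > r" for R
    using that by (intro homeomorphism_outside_ball[OF cont proper])
  have "\<forall>\<^sub>F R in at_top. \<exists>g. homeomorphism (X - cball 0 R) (?P ` (X - cball 0 R)) ?P g"
    by (rule eventually_mono[OF eventually_gt_at_top[of r] homeo])
  \<comment> \<open>The option type has one more element than \<open>'k\<close>, so keeping the
    dimension of \<open>X\<close> means codimension one.\<close>
  moreover have "pure_dimensional_algebraic_set (CARD('k option) - 1) (?P ` X)"
    using pure_dimensional_proper_image[OF poly assms(2) proper] by simp
  moreover have "X \<noteq> {}" using assms(1) by auto
  ultimately show ?thesis unfolding algebraic_hypersurface_def by blast
qed

end
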